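(* Let $N_5 = \Gamma_{P,\tau}\backslash(\mathbb{C}\ltimes_\rho\mathbb{C}^4)$ be the generalized Nakamura manifold described in the context, and let $J_t$, for $t=(t_1,t_2)\in\mathbb{R}^2$ with $|t|$ sufficiently small, be the almost-complex structure on $N_5$ defined in the context, with associated function $\alpha(t) = \frac{2t_2}{t_1^2+t_2^2-1}$. Then $$\kappa^{J_t}(N_5) = \begin{cases} -\infty & \text{if } \alpha(t)\notin\frac{2\pi}{k\lambda_2}\mathbb{Z}\ \text{ for all integers } k\ge1,\\ 0 & \text{otherwise.}\end{cases}$$
   Context: Setting. Let $M\in\mathrm{SL}(4,\mathbb{Z})$ and $P\in\mathrm{GL}(4,\mathbb{R})$ with $PMP^{-1} = \mathrm{diag}(e^{\lambda_1},e^{-\lambda_1},e^{\lambda_2},e^{-\lambda_2})$, $\lambda_1,\lambda_2\in\mathbb{R}$, $\lambda_2\ne0$, and let $\tau\in\mathbb{R}\setminus\{0\}$. With coordinates $(z,z_1,\dots,z_4)$ on $\mathbb{C}\times\mathbb{C}^4$, $z = x+iy$, $z_j = x_j+iy_j$, the group $\mathbb{C}\ltimes_\rho\mathbb{C}^4$ has product $(z',v')*(z,v) = (z'+z,\rho(z')v+v')$ with $\rho(z) = \mathrm{diag}(e^{\lambda_1x},e^{-\lambda_1x},e^{\lambda_2x},e^{-\lambda_2x})$. The lattice is $\Gamma_{P,\tau} = (\mathbb{Z}\oplus\tau\sqrt{-1}\,\mathbb{Z})\ltimes_\rho(P\mathbb{Z}^4\oplus\sqrt{-1}\,P\mathbb{Z}^4)$.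 A global real coframe on $N_5$ is given by $E^0 = dx$, $F^0 = dy$; $E^1 = e^{-\lambda_1x}dx_1$, $F^1 = e^{\lambda_1x}dx_2$; $E^2 = e^{-\lambda_1x}dy_1$, $F^2 = e^{\lambda_1x}dy_2$; $E^3 = e^{-\lambda_2x}dx_3$, $F^3 = e^{\lambda_2x}dx_4$; $E^4 = e^{-\lambda_2x}dy_3$, $F^4 = e^{\lambda_2x}dy_4$. For $t=(t_1,t_2)\in\mathbb{R}^2$ with $|t|$ sufficiently small, put $\alpha(t) = \frac{2t_2}{t_1^2+t_2^2-1}$ and $\beta(t) = \frac{(1-t_1)^2+t_2^2}{t_1^2+t_2^2-1}$. The almost-complex structure $J_t$ is the one whose $(1,0)$-forms are spanned by the global coframe $\phi_t^j = E^j+iF^j$ for $j=0,1,2,3$, and $\phi_t^4 = E^4-i\left[\alpha(t)E^4+\beta(t)F^4\right]$. Kodaira dimension of a compact almost-complex manifold $(X,\mathcal{J})$ of real dimension $2d$: let $P_{r,\mathcal{J}} = \dim_{\mathbb{C}} H^0(X,(\Lambda^{d,0}X)^{\otimes r})$ be the dimension of the space of smooth sections of $(\Lambda^{d,0}X)^{\otimes r}$ annihilated by $\bar\partial_r$, where $\bar\partial_1 = \bar\partial:\Lambda^{d,0}\to\Lambda^{d,1}\cong\Lambda^{0,1}\otimes\Lambda^{d,0}$ (the $(d,1)$-component of the exterior derivative) and $\bar\partial_r$ is its extension to tensor powers by the Leibniz rule. Then $\kappa^{\mathcal{J}}(X) = -\infty$ if $P_{r,\mathcal{J}}=0$ for all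 $r\ge1$, and $\kappa^{\mathcal{J}}(X) = \limsup_{r\to+\infty}\frac{\log P_{r,\mathcal{J}}}{\log r}$ otherwise. *)

theory Defs
  imports "HOL-Analysis.Analysis" "HOL-Library.Function_Algebras"
begin

section \<open>Smooth functions and complex spans\<close>

primrec C_k_on :: "nat \<Rightarrow> 'a::euclidean_space set \<Rightarrow> ('a \<Rightarrow> complex) \<Rightarrow> bool" where
  "C_k_on 0 U f \<longleftrightarrow> continuous_on U f"
| "C_k_on (Suc k) U f \<longleftrightarrow>
     (\<exists>f'. (\<forall>x\<in>U. (f has_derivative f' x) (at x)) \<and> (\<forall>v. C_k_on k U (\<lambda>x. f' x v)))"

definition smooth_on :: "'a::euclidean_space set \<Rightarrow> ('a \<Rightarrow> complex) \<Rightarrow> bool" where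
  "smooth_on U f \<longleftrightarrow> (\<forall>k. C_k_on k U f)"

definition cspan :: "('a \<Rightarrow> complex) set \<Rightarrow> ('a \<Rightarrow> complex) set" where
  "cspan = module.span (\<lambda>c f x. c * f x)"


section \<open>Exterior algebra of one tangent space\<close>

text \<open>
  A complex-valued \<open>k\<close>-covector on a real vector space is a function on lists of tangent vectors
  that vanishes on all lists whose length is not \<open>k\<close>. The function \<open>alt\<close> antisymmetrises in the
  first slot; in particular \<open>alt (\<lambda>(v, us). a v * \<eta> us)\<close> is the wedge product of the \<open>1\<close>-covector
  \<open>a\<close> with \<open>\<eta>\<close>, normalised so that a wedge product of \<open>1\<close>-covectors evaluates to a determinant.
\<close>

definition alt :: "('e \<times> 'e list \<Rightarrow> complex) \<Rightarrow> 'e list \<Rightarrow> complex" where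
  "alt h vs = (\<Sum>i<length vs. (-1) ^ i * h (vs ! i, take i vs @ drop (Suc i) vs))"

primrec wedge :: "('e \<Rightarrow> complex) list \<Rightarrow> 'e list \<Rightarrow> complex" where
  "wedge [] = (\<lambda>vs. if vs = [] then 1 else 0)"
| "wedge (a # as) = alt (\<lambda>(v, us). a v * wedge as us)"

text \<open>Below, \<open>J\<close> is a complex structure on the tangent space.\<close>

definition covectors_10 :: "('e::euclidean_space \<Rightarrow> 'e) \<Rightarrow> ('e \<Rightarrow> complex) set" where
  "covectors_10 J = {a. linear a \<and> (\<forall>v. a (J v) = \<i> * a v)}"

definition covectors_01 :: "('e::euclidean_space \<Rightarrow> 'e) \<Rightarrow> ('e \<Rightarrow> complex) set" where
  "covectors_01 J = {a. linear a \<and> (\<forall>v. a (J v) = - \<i> * a v)}"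

definition Lambda :: "('e::euclidean_space \<Rightarrow> 'e) \<Rightarrow> nat \<Rightarrow> nat \<Rightarrow> ('e list \<Rightarrow> complex) set" where
  "Lambda J p q = cspan {wedge (as @ bs) | as bs.
     length as = p \<and> set as \<subseteq> covectors_10 J \<and> length bs = q \<and> set bs \<subseteq> covectors_01 J}"

definition component ::
    "('e::euclidean_space \<Rightarrow> 'e) \<Rightarrow> nat \<Rightarrow> nat \<Rightarrow> ('e list \<Rightarrow> complex) \<Rightarrow> 'e list \<Rightarrow> complex" where
  "component J p q \<omega> = (THE \<eta>. \<exists>c. (\<forall>i\<le>p + q. c i \<in> Lambda J i (p + q - i)) \<and>
     (\<forall>vs. \<omega> vs = (\<Sum>i\<le>p + q. c i vs)) \<and> \<eta> = c p)"

text \<open>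
  Tensor products of spaces of functions are realised as spaces of functions on the product of
  the arguments: \<open>\<Lambda>\<^sup>0\<^sup>,\<^sup>1 \<otimes> \<Lambda>\<^sup>d\<^sup>,\<^sup>0\<close> is spanned by the functions \<open>(v, us) \<mapsto> b v * e us\<close>, and the \<open>r\<close>-th
  tensor power of \<open>\<Lambda>\<^sup>d\<^sup>,\<^sup>0\<close> by the functions \<open>[us\<^sub>1, \<dots>, us\<^sub>r] \<mapsto> e\<^sub>1 us\<^sub>1 * \<dots> * e\<^sub>r us\<^sub>r\<close>. On the former,
  \<open>alt\<close> is the isomorphism onto \<open>\<Lambda>\<^sup>d\<^sup>,\<^sup>1\<close> that sends \<open>b \<otimes> e\<close> to the wedge product of \<open>b\<close> and \<open>e\<close>.
\<close>

definition tensor_01_Lambda ::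
    "('e::euclidean_space \<Rightarrow> 'e) \<Rightarrow> nat \<Rightarrow> ('e \<times> 'e list \<Rightarrow> complex) set" where
  "tensor_01_Lambda J d =
     cspan {(\<lambda>(v, us). b v * e us) | b e. b \<in> covectors_01 J \<and> e \<in> Lambda J d 0}"

definition tensor :: "('e list \<Rightarrow> complex) list \<Rightarrow> 'e list list \<Rightarrow> complex" where
  "tensor es uss =
     (if length uss = length es then (\<Prod>i<length es. (es ! i) (uss ! i)) else 0)"

definition Lambda_power ::
    "('e::euclidean_space \<Rightarrow> 'e) \<Rightarrow> nat \<Rightarrow> nat \<Rightarrow> ('e list list \<Rightarrow> complex) set" where
  "Lambda_power J d r = cspan {tensor es | es. length es = r \<and> set es \<subseteq> Lambda J d 0}"


section \<open>The Dolbeault operator on tensor powers of the canonical bundle\<close>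

text \<open>
  Here we work on open subsets of the Euclidean space \<open>'e\<close>, with an almost-complex structure
  \<open>J x\<close> on the tangent space at each point \<open>x\<close>. The complex dimension \<open>d\<close> is half of the dimension
  of \<open>'e\<close>.
\<close>

definition ext_deriv ::
    "('e::euclidean_space \<Rightarrow> 'e list \<Rightarrow> complex) \<Rightarrow> 'e \<Rightarrow> 'e list \<Rightarrow> complex" where
  "ext_deriv \<omega> x = alt (\<lambda>(v, us). frechet_derivative (\<lambda>y. \<omega> y us) (at x) v)"

definition canonical_sections ::
    "nat \<Rightarrow> ('e::euclidean_space \<Rightarrow> 'e \<Rightarrow> 'e) \<Rightarrow> 'e set \<Rightarrow> ('e \<Rightarrow> 'e list \<Rightarrow> complex) set" where
  "canonical_sections d J V =
     {s. (\<forall>x\<in>V. s x \<in> Lambda (J x) d 0) \<and> (\<forall>us. smooth_on V (\<lambda>x. s x us))}"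

definition dbar ::
    "nat \<Rightarrow> ('e::euclidean_space \<Rightarrow> 'e \<Rightarrow> 'e) \<Rightarrow> ('e \<Rightarrow> 'e list \<Rightarrow> complex) \<Rightarrow>
     'e \<Rightarrow> 'e \<times> 'e list \<Rightarrow> complex" where
  "dbar d J s x = (THE \<theta>. \<theta> \<in> tensor_01_Lambda (J x) d \<and>
     alt \<theta> = component (J x) d 1 (ext_deriv s x))"

text \<open>
  The value at \<open>x\<close> of the extension of \<open>dbar\<close> to the \<open>r\<close>-th tensor power: near \<open>x\<close>, the section
  \<open>\<sigma>\<close> is written as a finite sum of tensors \<open>s l 0 \<otimes> \<dots> \<otimes> s l (r - 1)\<close> of smooth sections of the
  canonical bundle, to which linearity and the Leibniz rule are applied.
\<close>

definition has_dbar_power ::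
    "nat \<Rightarrow> ('e::euclidean_space \<Rightarrow> 'e \<Rightarrow> 'e) \<Rightarrow> nat \<Rightarrow> ('e \<Rightarrow> 'e list list \<Rightarrow> complex) \<Rightarrow>
     'e \<Rightarrow> ('e \<times> 'e list list \<Rightarrow> complex) \<Rightarrow> bool" where
  "has_dbar_power d J r \<sigma> x \<theta> \<longleftrightarrow>
     (\<exists>V n s. open V \<and> x \<in> V \<and>
        (\<forall>l<n. \<forall>i<r. s l i \<in> canonical_sections d J V) \<and>
        (\<forall>y\<in>V. \<sigma> y = (\<lambda>uss. \<Sum>l<(n::nat). tensor (map (\<lambda>i. s l i y) [0..<r]) uss)) \<and>
        \<theta> = (\<lambda>(v, uss). if length uss = r
          then \<Sum>l<n. \<Sum>j<r. dbar d J (s l j) x (v, uss ! j) *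
                 (\<Prod>i\<in>{..<r} - {j}. s l i x (uss ! i))
          else 0))"


section \<open>Kodaira dimension of an almost-complex manifold\<close>

text \<open>
  A manifold is given by an atlas of local parametrisations \<open>(U, \<psi>)\<close>, i.e. inverses of charts:
  \<open>U\<close> is an open subset of the model space \<open>'e\<close> and \<open>\<psi>\<close> is an injective map from \<open>U\<close> to the
  manifold. Tensor fields are families of local expressions, one on each \<open>U\<close>, that are
  compatible with the transition maps. This includes the almost-complex structure \<open>J\<close>. To make
  the representation unique, local expressions of sections are \<open>0\<close> outside \<open>U\<close> and for pairs that
  do not belong to the atlas.
\<close>

type_synonym ('e, 'm) param = "'e set \<times> ('e \<Rightarrow> 'm)"

definition transition :: "('e, 'm) param \<Rightarrow> ('e, 'm) param \<Rightarrow> 'e \<Rightarrow> 'e" where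
  "transition c c' = inv_into (fst c') (snd c') \<circ> snd c"

definition pluricanonical_sections ::
    "('e::euclidean_space, 'm) param set \<Rightarrow> (('e, 'm) param \<Rightarrow> 'e \<Rightarrow> 'e \<Rightarrow> 'e) \<Rightarrow> nat \<Rightarrow>
     (('e, 'm) param \<Rightarrow> 'e \<Rightarrow> 'e list list \<Rightarrow> complex) set" where
  "pluricanonical_sections A J r = {\<sigma>.
     (\<forall>c x uss. c \<notin> A \<or> x \<notin> fst c \<longrightarrow> \<sigma> c x uss = 0) \<and>
     (\<forall>c\<in>A. \<forall>x\<in>fst c. \<sigma> c x \<in> Lambda_power (J c x) (DIM('e) div 2) r) \<and>
     (\<forall>c\<in>A. \<forall>uss. smooth_on (fst c) (\<lambda>x. \<sigma> c x uss)) \<and>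
     (\<forall>c\<in>A. \<forall>c'\<in>A. \<forall>x\<in>fst c. snd c x \<in> snd c' ` fst c' \<longrightarrow>
        (\<forall>uss. \<sigma> c x uss = \<sigma> c' (transition c c' x)
           (map (map (frechet_derivative (transition c c') (at x))) uss)))}"

definition H0 ::
    "('e::euclidean_space, 'm) param set \<Rightarrow> (('e, 'm) param \<Rightarrow> 'e \<Rightarrow> 'e \<Rightarrow> 'e) \<Rightarrow> nat \<Rightarrow>
     (('e, 'm) param \<Rightarrow> 'e \<Rightarrow> 'e list list \<Rightarrow> complex) set" where
  "H0 A J r = {\<sigma> \<in> pluricanonical_sections A J r.
     \<forall>c\<in>A. \<forall>x\<in>fst c. has_dbar_power (DIM('e) div 2) (J c) r (\<sigma> c) x (\<lambda>_. 0)}"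

abbreviation scale_section ::
    "complex \<Rightarrow> ('c \<Rightarrow> 'e \<Rightarrow> 'l \<Rightarrow> complex) \<Rightarrow> 'c \<Rightarrow> 'e \<Rightarrow> 'l \<Rightarrow> complex" where
  "scale_section \<equiv> (\<lambda>a \<sigma> c x uss. a * \<sigma> c x uss)"

text \<open>The library's \<open>dim\<close> is \<open>0\<close> on infinite-dimensional spaces, hence the case distinction.\<close>

definition plurigenus ::
    "('e::euclidean_space, 'm) param set \<Rightarrow> (('e, 'm) param \<Rightarrow> 'e \<Rightarrow> 'e \<Rightarrow> 'e) \<Rightarrow> nat \<Rightarrow> enat" where
  "plurigenus A J r =
     (if \<exists>B. finite B \<and> H0 A J r \<subseteq> module.span scale_section B
      then enat (vector_space.dim scale_section (H0 A J r)) else \<infinity>)"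

definition log_enat :: "enat \<Rightarrow> ereal" where
  "log_enat n = (case n of enat m \<Rightarrow> if m = 0 then - \<infinity> else ereal (ln (real m)) | \<infinity> \<Rightarrow> \<infinity>)"

definition kodaira_dim ::
    "('e::euclidean_space, 'm) param set \<Rightarrow> (('e, 'm) param \<Rightarrow> 'e \<Rightarrow> 'e \<Rightarrow> 'e) \<Rightarrow> ereal" where
  "kodaira_dim A J =
     (if \<forall>r\<ge>1. plurigenus A J r = 0 then - \<infinity>
      else limsup (\<lambda>r. log_enat (plurigenus A J r) / ereal (ln (real r))))"


section \<open>The generalized Nakamura manifold\<close>

type_synonym CxC4 = "complex \<times> (complex^4)"

definition weight :: "real \<Rightarrow> real \<Rightarrow> real^4" where
  "weight l1 l2 =
     (\<chi> j. if j = 1 then l1 else if j = 2 then - l1 else if j = 3 then l2 else - l2)"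

definition exp_diag :: "real \<Rightarrow> real \<Rightarrow> real^4^4" where
  "exp_diag l1 l2 = (\<chi> i j. if i = j then exp (weight l1 l2 $ i) else 0)"

definition rho :: "real \<Rightarrow> real \<Rightarrow> complex \<Rightarrow> complex^4 \<Rightarrow> complex^4" where
  "rho l1 l2 z v = (\<chi> j. of_real (exp (weight l1 l2 $ j * Re z)) * v $ j)"

definition sdprod :: "real \<Rightarrow> real \<Rightarrow> CxC4 \<Rightarrow> CxC4 \<Rightarrow> CxC4" where
  "sdprod l1 l2 g' g = (fst g' + fst g, rho l1 l2 (fst g') (snd g) + snd g')"

definition Gamma :: "real^4^4 \<Rightarrow> real \<Rightarrow> CxC4 set" where
  "Gamma P \<tau> = {(Complex (of_int m) (\<tau> * of_int n),
       \<chi> j. Complex ((P *v (\<chi> i. of_int (a $ i))) $ j) ((P *v (\<chi> i. of_int (b $ i))) $ j))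
     | m n (a :: int^4) (b :: int^4). True}"

definition coset :: "real^4^4 \<Rightarrow> real \<Rightarrow> real \<Rightarrow> real \<Rightarrow> CxC4 \<Rightarrow> CxC4 set" where
  "coset P \<tau> l1 l2 g = (\<lambda>\<gamma>. sdprod l1 l2 \<gamma> g) ` Gamma P \<tau>"

text \<open>
  The points of the quotient are the cosets, and the local parametrisations are the restrictions
  of the quotient map to the open sets on which it is injective.
\<close>

definition N5 :: "real^4^4 \<Rightarrow> real \<Rightarrow> real \<Rightarrow> real \<Rightarrow> (CxC4, CxC4 set) param set" where
  "N5 P \<tau> l1 l2 =
     {(U, coset P \<tau> l1 l2) | U. open U \<and> inj_on (coset P \<tau> l1 l2) U}"

text \<open>
  The coframe at the point \<open>g\<close>, evaluated on the tangent vector \<open>w\<close>. These forms are invariant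
  under left translation by the lattice, so in every parametrisation of the quotient they are
  given by the same formula.
\<close>

definition coframe_E :: "real \<Rightarrow> real \<Rightarrow> nat \<Rightarrow> CxC4 \<Rightarrow> CxC4 \<Rightarrow> real" where
  "coframe_E l1 l2 j g w =
     [Re (fst w),
      exp (- l1 * Re (fst g)) * Re (snd w $ 1),
      exp (- l1 * Re (fst g)) * Im (snd w $ 1),
      exp (- l2 * Re (fst g)) * Re (snd w $ 3),
      exp (- l2 * Re (fst g)) * Im (snd w $ 3)] ! j"

definition coframe_F :: "real \<Rightarrow> real \<Rightarrow> nat \<Rightarrow> CxC4 \<Rightarrow> CxC4 \<Rightarrow> real" where
  "coframe_F l1 l2 j g w =
     [Im (fst w),
      exp (l1 * Re (fst g)) * Re (snd w $ 2),
      exp (l1 * Re (fst g)) * Im (snd w $ 2),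
      exp (l2 * Re (fst g)) * Re (snd w $ 4),
      exp (l2 * Re (fst g)) * Im (snd w $ 4)] ! j"

definition alpha :: "real^2 \<Rightarrow> real" where
  "alpha t = 2 * t $ 2 / ((t $ 1)^2 + (t $ 2)^2 - 1)"

definition beta :: "real^2 \<Rightarrow> real" where
  "beta t = ((1 - t $ 1)^2 + (t $ 2)^2) / ((t $ 1)^2 + (t $ 2)^2 - 1)"

definition phi :: "real \<Rightarrow> real \<Rightarrow> real^2 \<Rightarrow> nat \<Rightarrow> CxC4 \<Rightarrow> CxC4 \<Rightarrow> complex" where
  "phi l1 l2 t j g w =
     (if j < 4
      then of_real (coframe_E l1 l2 j g w) + \<i> * of_real (coframe_F l1 l2 j g w)
      else of_real (coframe_E l1 l2 4 g w) - \<i> * of_real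
             (alpha t * coframe_E l1 l2 4 g w + beta t * coframe_F l1 l2 4 g w))"

definition J_nak :: "real \<Rightarrow> real \<Rightarrow> real^2 \<Rightarrow> CxC4 \<Rightarrow> CxC4 \<Rightarrow> CxC4" where
  "J_nak l1 l2 t g = (THE J. linear J \<and> (\<forall>w. J (J w) = - w) \<and>
     covectors_10 J = cspan {phi l1 l2 t j g | j. j \<le> 4})"

text \<open>As for the coframe, the local expression of the almost-complex structure is always the same.\<close>

definition J_N5 ::
    "real \<Rightarrow> real \<Rightarrow> real^2 \<Rightarrow> (CxC4, CxC4 set) param \<Rightarrow> CxC4 \<Rightarrow> CxC4 \<Rightarrow> CxC4" where
  "J_N5 l1 l2 t c = J_nak l1 l2 t"

end

theory Submission
  imports Defs "HOL-Complex_Analysis.Cauchy_Integral_Formula"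
begin

text \<open>
  The form \<open>\<Omega> = \<phi>\<^sup>0 \<and> \<dots> \<and> \<phi>\<^sup>4\<close> trivialises the canonical bundle. Differentiating the coframe, only
  \<open>\<phi>\<^sup>4\<close> contributes to the \<open>(5,1)\<close>-part of \<open>d\<Omega>\<close>, which is the wedge product of \<open>\<i> \<alpha> \<lambda>\<^sub>2 / 2 \<sqdot> cnj \<phi>\<^sup>0\<close>
  with \<open>\<Omega>\<close>. Hence \<open>F \<Omega>\<^sup>r\<close> is annihilated by the Dolbeault operator iff \<open>F\<close> satisfies the
  Cauchy-Riemann equations along the fibres of the projection to \<open>z\<close>, and \<open>F exp (\<i> r \<alpha> \<lambda>\<^sub>2 x)\<close>
  satisfies them along the base. As \<open>F\<close> is invariant under the cocompact lattice, it is bounded, and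
  Liouville's theorem gives \<open>F = C exp (- \<i> r \<alpha> \<lambda>\<^sub>2 x)\<close>. This has period \<open>1\<close> in \<open>x\<close> iff \<open>C = 0\<close> or
  \<open>r \<alpha> \<lambda>\<^sub>2 \<in> 2\<pi>\<int>\<close>, so the \<open>r\<close>-th plurigenus is \<open>1\<close> or \<open>0\<close> accordingly.
\<close>

section \<open>Complex spans\<close>

text \<open>The definite descriptions shape the proof. \<open>J_nak\<close>,
  \<open>component\<close> and \<open>dbar\<close> can be computed only after existence and
  uniqueness are known. The linear algebra therefore provides an explicit inverse of the coframe,
  uniqueness of the type decomposition, and injectivity of the wedge product of (0,1)-covectors with
  the top form. Likewise, \<open>has_dbar_power\<close> only asserts that some local presentation by
  sums of tensors works. Since \<Omega> trivialises the canonical bundle, every presentation turns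
  into a sum of products of scalar functions, for which the Leibniz rule is the ordinary one.

  Why \<phi>^4 is exceptional: differentiation in x multiplies E^j by -l and F^j by l, with l = l1
  or l2, so it sends E + iF to a multiple of its conjugate. The deformation replaces F^4 by a
  combination of E^4 and F^4, and a multiple \<i> \<alpha> l2 of \<phi>^4 itself survives. The
  factor 1/2 comes from dx = (\<phi>^0 + cnj \<phi>^0) / 2, whose first half is killed by the factor
  \<phi>^0 of \<Omega>.\<close>

interpretation cfun: vector_space "\<lambda>(c::complex) (f::'a \<Rightarrow> complex) x. c * f x"
  by unfold_locales (auto simp: fun_eq_iff algebra_simps)

interpretation csec: vector_space
    "scale_section :: complex \<Rightarrow> ('c \<Rightarrow> 'e \<Rightarrow> 'l \<Rightarrow> complex) \<Rightarrow> 'c \<Rightarrow> 'e \<Rightarrow> 'l \<Rightarrow> complex"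
  by standard (simp_all add: fun_eq_iff distrib_left distrib_right)

lemma cspan_base: "f \<in> S \<Longrightarrow> f \<in> cspan S"
  unfolding cspan_def by (rule cfun.span_base)

lemma cspan_zero: "(\<lambda>_. 0) \<in> cspan S"
  unfolding cspan_def using cfun.span_zero[of S] by (simp add: zero_fun_def)

lemma cspan_add: "f \<in> cspan S \<Longrightarrow> g \<in> cspan S \<Longrightarrow> (\<lambda>x. f x + g x) \<in> cspan S"
  unfolding cspan_def using cfun.span_add[of f S g] by (simp add: plus_fun_def)

lemma cspan_scale: "f \<in> cspan S \<Longrightarrow> (\<lambda>x. c * f x) \<in> cspan S"
  unfolding cspan_def by (rule cfun.span_scale)

lemma cspan_sum: "(\<And>i. i \<in> I \<Longrightarrow> f i \<in> cspan S) \<Longrightarrow> (\<lambda>x. \<Sum>i\<in>I. f i x) \<in> cspan S"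
  by (induction I rule: infinite_finite_induct) (auto intro: cspan_zero cspan_add)

lemma cspan_induct [consumes 1, case_names zero add scale base]:
  assumes "f \<in> cspan S" "P (\<lambda>_. 0)"
    and "\<And>f g. P f \<Longrightarrow> P g \<Longrightarrow> P (\<lambda>x. f x + g x)"
    and "\<And>c f. P f \<Longrightarrow> P (\<lambda>x. c * f x)"
    and "\<And>f. f \<in> S \<Longrightarrow> P f"
  shows "P f"
  using assms(1) unfolding cspan_def
proof (induction rule: cfun.span_induct_alt)
  case base
  then show ?case using assms(2) by (simp add: zero_fun_def)
next
  case (step c x y)
  then show ?case using assms(3)[of "\<lambda>z. c * x z" y] assms(4,5) by (simp add: plus_fun_def)
qed

lemma cspan_subset:
  assumes "S \<subseteq> cspan T"
  shows "cspan S \<subseteq> cspan T"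
proof
  fix f assume "f \<in> cspan S"
  then show "f \<in> cspan T"
    by (induction rule: cspan_induct) (use assms in \<open>auto intro: cspan_zero cspan_add cspan_scale\<close>)
qed

lemma cspan_singleton: "cspan {f} = {\<lambda>x. c * f x | c. True}"
  unfolding cspan_def cfun.span_singleton by auto

section \<open>Wedge products of covectors\<close>

lemma alt_linear:
  "alt (\<lambda>p. a * h p + b * k p) vs = a * alt h vs + b * alt k vs"
  by (simp add: alt_def sum_distrib_left sum.distrib algebra_simps)

lemma alt_zero: "alt (\<lambda>_. 0) vs = 0"
  by (simp add: alt_def)

lemma alt_scale: "alt (\<lambda>p. a * h p) vs = a * alt h vs"
  using alt_linear[of a h 0 h] by simp

lemma alt_add: "alt (\<lambda>p. h p + k p) vs = alt h vs + alt k vs"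
  using alt_linear[of 1 h 1 k] by simp

lemma alt_sum: "alt (\<lambda>p. \<Sum>i\<in>I. h i p) vs = (\<Sum>i\<in>I. alt (h i) vs)"
  by (induction I rule: infinite_finite_induct) (auto simp: alt_zero alt_add)

lemma alt_scale_right: "alt (\<lambda>(v, us). a v * (c * h us)) vs = c * alt (\<lambda>(v, us). a v * h us) vs"
proof -
  have "(\<lambda>(v, us). a v * (c * h us)) = (\<lambda>p. c * (case p of (v, us) \<Rightarrow> a v * h us))"
    by (auto simp: mult.left_commute)
  then show ?thesis by (simp add: alt_scale)
qed

lemma alt_add_right:
  "alt (\<lambda>(v, us). a v * (h us + k us)) vs = alt (\<lambda>(v, us). a v * h us) vs + alt (\<lambda>(v, us). a v * k us) vs"
proof -
  have "(\<lambda>(v, us). a v * (h us + k us)) = (\<lambda>p. (case p of (v, us) \<Rightarrow> a v * h us) + (case p of (v, us) \<Rightarrow> a v * k us))"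
    by (auto simp: distrib_left)
  then show ?thesis by (simp add: alt_add)
qed

lemma nth_remove:
  "i < length vs \<Longrightarrow> k < length vs - 1 \<Longrightarrow>
     (take i vs @ drop (Suc i) vs) ! k = vs ! (if k < i then k else Suc k)"
  by (auto simp: nth_append min_def)

text \<open>The face identity of simplicial sets: once position k < i is gone, the old position i is
  called i - 1. It pairs off the terms in \<open>alt_alt\<close>.\<close>

lemma remove_remove:
  assumes "i < length vs" "k < i"
  shows "take k (take i vs @ drop (Suc i) vs) @ drop (Suc k) (take i vs @ drop (Suc i) vs)
       = take (i - 1) (take k vs @ drop (Suc k) vs) @ drop (Suc (i - 1)) (take k vs @ drop (Suc k) vs)"
proof -
  have "i = Suc (k + (i - Suc k))" using assms by simp
  then obtain j where i: "i = Suc (k + j)" by blast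
  have "vs = take k vs @ vs ! k # drop (Suc k) vs" using assms by (simp add: id_take_nth_drop)
  then show ?thesis using assms
    by (intro nth_equalityI) (auto simp: i nth_append)
qed

text \<open>Two distinct entries can be extracted in two orders. Extracting the later one first
  leaves the index of the earlier one untouched; in the opposite order the later index has dropped
  by one, hence the opposite sign.\<close>

lemma alt_alt:
  "alt (\<lambda>(v, us). alt (\<lambda>(w, ws). h v w ws) us) vs = - alt (\<lambda>(v, us). alt (\<lambda>(w, ws). h w v ws) us) vs"
proof -
  let ?n = "length vs"
  define D where "D i us = take i us @ drop (Suc i) us" for i and us :: "'a list"
  define T where "T h i k = (-1::complex) ^ (i + k) * h (vs ! i) (D i vs ! k) (D k (D i vs))" for h i k
  have *: "alt (\<lambda>(v, us). alt (\<lambda>(w, ws). h v w ws) us) vs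
      = (\<Sum>(i, k)\<in>{..<?n} \<times> {..<?n - 1}. T h i k)" for h
  proof -
    have "alt (\<lambda>(v, us). alt (\<lambda>(w, ws). h v w ws) us) vs = (\<Sum>i<?n. \<Sum>k<?n - 1. T h i k)"
      unfolding alt_def prod.case
    proof (rule sum.cong[OF refl], subst sum_distrib_left, rule sum.cong)
      fix i assume "i \<in> {..<?n}"
      then show "{..<length (take i vs @ drop (Suc i) vs)} = {..<?n - 1}" by simp
    qed (simp add: T_def D_def power_add)
    then show ?thesis by (simp add: sum.cartesian_product)
  qed
  \<comment> \<open>The involution exchanging the two orders of extraction. The second index refers
    to the shortened list, whence the shifts.\<close>
  define s where "s = (\<lambda>(i, k). if k < i then (k, i - 1) else (Suc k, i::nat))"
  have DD: "D k (D i vs) = D (i - 1) (D k vs)" if "i < ?n" "k < i" for i k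
    unfolding D_def by (rule remove_remove) (use that in auto)
  have Dn: "D i vs ! k = vs ! (if k < i then k else Suc k)" if "i < ?n" "k < ?n - 1" for i k
    unfolding D_def by (rule nth_remove) (use that in auto)
  have "(\<Sum>(i, k)\<in>{..<?n} \<times> {..<?n - 1}. T h i k)
      = (\<Sum>(i, k)\<in>{..<?n} \<times> {..<?n - 1}. - T (\<lambda>v w. h w v) i k)"
  proof (rule sum.reindex_bij_witness[of _ s s])
    fix p assume p: "p \<in> {..<?n} \<times> {..<?n - 1}"
    then show "s (s p) = p" "s p \<in> {..<?n} \<times> {..<?n - 1}" "s (s p) = p"
      "s p \<in> {..<?n} \<times> {..<?n - 1}"
      by (auto simp: s_def split: if_splits)
    obtain i k where ik: "p = (i, k)" "i < ?n" "k < ?n - 1" using p by auto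
    show "(case s p of (i, k) \<Rightarrow> - T (\<lambda>v w. h w v) i k) = (case p of (i, k) \<Rightarrow> T h i k)"
    proof (cases "k < i")
      case True
      then obtain j where j: "i = Suc j" by (cases i) auto
      show ?thesis using True ik DD[of i k] unfolding ik s_def
        by (simp add: T_def Dn j power_add)
    next
      case False
      show ?thesis using False ik DD[of "Suc k" i] unfolding ik s_def
        by (simp add: T_def Dn power_add)
    qed
  qed
  then show ?thesis unfolding *[of h] *[of "\<lambda>v w. h w v"] by (simp add: sum_negf split_def)
qed

lemma wedge_Cons: "wedge (a # as) vs = alt (\<lambda>(v, us). a v * wedge as us) vs"
  by simp

declare wedge.simps(2) [simp del]

section \<open>Sign rules and multilinearity of wedge products\<close>

lemma wedge_swap: "wedge (a # b # as) = (\<lambda>vs. - wedge (b # a # as) vs)"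
proof
  fix vs :: "'a list"
  have *: "wedge (a # b # as) vs
      = alt (\<lambda>(v, us). alt (\<lambda>(w, ws). a v * b w * wedge as ws) us) vs" for a b :: "'a \<Rightarrow> complex"
    by (simp only: wedge_Cons split_def alt_scale[symmetric] mult.assoc)
  show "wedge (a # b # as) vs = - wedge (b # a # as) vs"
    unfolding * by (subst alt_alt) (simp add: mult.commute)
qed

lemma wedge_Cons_cong: "wedge as = (\<lambda>us. c * wedge bs us) \<Longrightarrow> wedge (a # as) = (\<lambda>us. c * wedge (a # bs) us)"
  by (rule ext) (simp only: wedge_Cons alt_scale_right)

lemma wedge_move: "wedge (as @ c # bs) = (\<lambda>vs. (-1) ^ length as * wedge (c # as @ bs) vs)"
proof (induction as)
  case (Cons a as)
  from wedge_Cons_cong[OF Cons, of a] show ?case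
    by (simp add: wedge_swap[of a c])
qed simp

text \<open>The factor is a sign. Its value is left open because the lemma only serves to place
  wedge products in complex spans.\<close>

lemma wedge_mset:
  "mset as = mset bs \<Longrightarrow> \<exists>c. wedge as = (\<lambda>vs. c * wedge bs vs)"
proof (induction as arbitrary: bs)
  case Nil
  then show ?case by (auto intro!: exI[of _ 1])
next
  case (Cons a as)
  then have "a \<in> set bs" by (metis list.set_intros(1) set_mset_mset)
  then obtain xs ys where bs: "bs = xs @ a # ys" by (meson split_list)
  with Cons.prems have "mset as = mset (xs @ ys)" by simp
  then obtain c where "wedge as = (\<lambda>vs. c * wedge (xs @ ys) vs)" using Cons.IH by blast
  from wedge_Cons_cong[OF this, of a]
  have "wedge (a # as) = (\<lambda>vs. (c * (-1) ^ length xs) * wedge bs vs)"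
    by (simp add: bs wedge_move[of xs] fun_eq_iff flip: power_mult_distrib power_add mult_2)
  then show ?case by blast
qed

lemma wedge_repeat:
  assumes "a \<in> set as"
  shows "wedge (a # as) = (\<lambda>_. 0)"
proof -
  have *: "wedge (a # a # as) = (\<lambda>_. 0)" for a :: "'a \<Rightarrow> complex" and as
    using fun_cong[OF wedge_swap[of a a as]] by (auto simp: fun_eq_iff)
  from assms show ?thesis
  proof (induction as)
    case (Cons b as)
    show ?case
    proof (cases "a = b")
      case False
      with Cons have "wedge (a # as) = (\<lambda>us. 0 * wedge as us)" by simp
      from wedge_Cons_cong[OF this, of b] show ?thesis by (simp add: wedge_swap[of a b])
    qed (simp add: *)
  qed simp
qed

lemma wedge_not_distinct: "\<not> distinct as \<Longrightarrow> wedge as = (\<lambda>_. 0)"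
proof (induction as)
  case (Cons a as)
  then show ?case
  proof (cases "a \<in> set as")
    case False
    with Cons have "wedge as = (\<lambda>us. 0 * wedge as us)" by simp
    from wedge_Cons_cong[OF this, of a] show ?thesis by simp
  qed (simp add: wedge_repeat)
qed simp

lemma wedge_slot_linear:
  "wedge (xs @ (\<lambda>v. a * f v + b * g v) # ys) vs
     = a * wedge (xs @ f # ys) vs + b * wedge (xs @ g # ys) vs"
proof (induction xs arbitrary: vs)
  case Nil
  have "(\<lambda>(v, us). (a * f v + b * g v) * wedge ys us)
      = (\<lambda>p. a * (case p of (v, us) \<Rightarrow> f v * wedge ys us) + b * (case p of (v, us) \<Rightarrow> g v * wedge ys us))"
    by (auto simp: distrib_right mult.assoc)
  then show ?case by (simp add: wedge_Cons alt_linear)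
next
  case (Cons c xs)
  have "(\<lambda>(v, us). c v * wedge (xs @ (\<lambda>v. a * f v + b * g v) # ys) us)
      = (\<lambda>p. a * (case p of (v, us) \<Rightarrow> c v * wedge (xs @ f # ys) us)
           + b * (case p of (v, us) \<Rightarrow> c v * wedge (xs @ g # ys) us))"
    by (auto simp: Cons algebra_simps)
  then show ?case by (simp add: wedge_Cons alt_linear)
qed

lemma wedge_head_add: "wedge ((\<lambda>v. f v + g v) # ys) vs = wedge (f # ys) vs + wedge (g # ys) vs"
  using wedge_slot_linear[of "[]" 1 f 1 g] by simp

lemma wedge_head_scale: "wedge ((\<lambda>v. c * f v) # ys) vs = c * wedge (f # ys) vs"
  using wedge_slot_linear[of "[]" c f 0 f] by simp

lemma wedge_head_zero: "wedge ((\<lambda>v. 0) # ys) vs = 0"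
  using wedge_head_scale[of 0] by simp

lemma wedge_in_cspan_lists:
  assumes "set as \<subseteq> cspan S"
  shows "wedge as \<in> cspan {wedge bs | bs. length bs = length as \<and> set bs \<subseteq> S}"
  using assms
proof (induction as)
  case Nil
  then show ?case by (auto intro!: cspan_base)
next
  case (Cons a as)
  let ?S = "{wedge bs | bs. length bs = Suc (length as) \<and> set bs \<subseteq> S}"
  have *: "(\<lambda>vs. alt (\<lambda>(v, us). b v * h us) vs) \<in> cspan ?S"
    if "b \<in> S" and "h \<in> cspan {wedge bs | bs. length bs = length as \<and> set bs \<subseteq> S}" for b h
    using that(2)
  proof (induction rule: cspan_induct)
    case zero
    then show ?case by (simp add: alt_zero split_def cspan_zero)
  next
    case (add f g)
    from cspan_add[OF add.IH] show ?case by (simp only: alt_add_right)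
  next
    case (scale c f)
    from cspan_scale[OF scale.IH, of c] show ?case by (simp only: alt_scale_right)
  next
    case (base f)
    then obtain bs where "f = wedge bs" "length bs = length as" "set bs \<subseteq> S" by auto
    then have "wedge (b # bs) \<in> ?S" using \<open>b \<in> S\<close> by fastforce
    then have "alt (\<lambda>(v, us). b v * f us) \<in> cspan ?S"
      by (simp only: \<open>f = wedge bs\<close> wedge.simps cspan_base)
    then show ?case by (simp only:)
  qed
  have "a \<in> cspan S" using Cons.prems by simp
  then have "wedge (a # as) \<in> cspan ?S"
  proof (induction rule: cspan_induct)
    case zero
    then show ?case by (simp add: wedge_head_zero[abs_def] cspan_zero)
  next
    case (add f g)
    from cspan_add[OF add.IH] show ?case by (simp only: wedge_head_add)
  next
    case (scale c f)
    from cspan_scale[OF scale.IH, of c] show ?case by (simp only: wedge_head_scale)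
  next
    case (base b)
    have "set as \<subseteq> cspan S" using Cons.prems by simp
    from *[OF \<open>b \<in> S\<close> Cons.IH[OF this]] show ?case by (simp only: wedge.simps)
  qed
  then show ?case by simp
qed

text \<open>After expansion in \<open>bs\<close>, a list with a repeated entry contributes zero, and
  by its length any other list is a permutation of \<open>bs\<close>. This is why the canonical
  bundle has rank one.\<close>

lemma wedge_top_cspan:
  assumes "distinct bs" "set as \<subseteq> cspan (set bs)" "length as = length bs"
  shows "wedge as \<in> cspan {wedge bs}"
proof -
  have "{wedge cs | cs. length cs = length as \<and> set cs \<subseteq> set bs} \<subseteq> cspan {wedge bs}"
  proof clarify
    fix cs assume cs: "length cs = length as" "set cs \<subseteq> set bs"
    show "wedge cs \<in> cspan {wedge bs}"
    proof (cases "distinct cs")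
      case True
      then have "set cs = set bs" using cs assms
        by (metis card_subset_eq distinct_card List.finite_set)
      then have "mset cs = mset bs" using True assms(1) set_eq_iff_mset_eq_distinct by blast
      then show ?thesis using wedge_mset[of cs bs] unfolding cspan_singleton by blast
    qed (simp add: wedge_not_distinct cspan_zero)
  qed
  then show ?thesis using wedge_in_cspan_lists[OF assms(2)] cspan_subset by blast
qed

lemma alt_map:
  "alt h (map T vs) = alt (\<lambda>(v, us). h (T v, map T us)) vs"
  by (auto simp: alt_def take_map drop_map intro!: sum.cong)

lemma wedge_map: "wedge as (map T vs) = wedge (map (\<lambda>a v. a (T v)) as) vs"
  by (induction as arbitrary: vs) (simp_all add: wedge_Cons alt_map split_def)

lemma wedge_scale_all:
  "wedge (map (\<lambda>a v. c * a v) as) vs = c ^ length as * wedge as vs"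
proof (induction as arbitrary: vs)
  case (Cons a as)
  have "wedge (map (\<lambda>a v. c * a v) (a # as)) vs
      = c * alt (\<lambda>(v, us). a v * (c ^ length as * wedge as us)) vs"
    by (simp add: wedge_head_scale) (simp add: wedge_Cons Cons)
  also have "\<dots> = c ^ length (a # as) * wedge (a # as) vs"
    by (simp only: wedge_Cons alt_scale_right) simp
  finally show ?case .
qed simp

text \<open>The determinant of a diagonal matrix. It is used with explicit test vectors to show that
  a top form does not vanish.\<close>

lemma wedge_diagonal:
  assumes "length as = length vs"
    and "\<And>i k. i < length as \<Longrightarrow> k < length as \<Longrightarrow> i \<noteq> k \<Longrightarrow> (as ! i) (vs ! k) = 0"
  shows "wedge as vs = (\<Prod>i<length as. (as ! i) (vs ! i))"
  using assms
proof (induction as vs rule: list_induct2)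
  case (Cons a as v vs)
  have "a (vs ! i) = 0" if "i < length vs" for i
    using Cons(3)[of 0 "Suc i"] that \<open>length as = length vs\<close> by simp
  moreover have "wedge as vs = (\<Prod>i<length as. (as ! i) (vs ! i))"
    by (rule Cons.IH) (use Cons(3)[of "Suc i" "Suc k" for i k] in auto)
  ultimately show ?case
    by (simp add: wedge_Cons alt_def sum.lessThan_Suc_shift prod.lessThan_Suc_shift
        del: sum.lessThan_Suc prod.lessThan_Suc)
qed simp

section \<open>Complex structures and the type decomposition\<close>

lemma wedge_scale_append:
  "wedge (map (\<lambda>a v. c * a v) as @ map (\<lambda>b v. c' * b v) bs) vs
     = c ^ length as * c' ^ length bs * wedge (as @ bs) vs"
proof (induction as arbitrary: vs)
  case (Cons a as)
  have "wedge (map (\<lambda>a v. c * a v) (a # as) @ map (\<lambda>b v. c' * b v) bs) vs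
      = c * wedge (a # map (\<lambda>a v. c * a v) as @ map (\<lambda>b v. c' * b v) bs) vs"
    by (simp add: wedge_head_scale)
  also have "\<dots> = c * alt (\<lambda>(v, us). a v * ((c ^ length as * c' ^ length bs) * wedge (as @ bs) us)) vs"
    by (simp only: wedge_Cons Cons)
  also have "\<dots> = c * ((c ^ length as * c' ^ length bs) * wedge (a # as @ bs) vs)"
    by (simp only: alt_scale_right wedge_Cons)
  finally show ?case by simp
qed (simp add: wedge_scale_all)

lemma linear_complex_scaleR:
  fixes a :: "'e::real_vector \<Rightarrow> complex"
  shows "linear a \<Longrightarrow> a (r *\<^sub>R v) = of_real r * a v"
  by (simp add: linear_cmul scaleR_conv_of_real)

text \<open>Lets the type be read off by counting, without first sorting the factors into (1,0)
  before (0,1) as \<open>Lambda\<close> demands.\<close>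

lemma Lambda_mset:
  assumes "mset L = mset (as @ bs)" "set as \<subseteq> covectors_10 J" "set bs \<subseteq> covectors_01 J"
    and "length as = p" "length bs = q"
  shows "wedge L \<in> Lambda J p q"
proof -
  obtain c where "wedge L = (\<lambda>vs. c * wedge (as @ bs) vs)" using wedge_mset[OF assms(1)] by blast
  moreover have "wedge (as @ bs) \<in> Lambda J p q"
    unfolding Lambda_def using assms by (intro cspan_base) auto
  ultimately show ?thesis by (simp add: Lambda_def cspan_scale)
qed

text \<open>Provides infinitely many roots for the polynomial in
  \<open>type_decomposition_unique\<close>.\<close>

lemma infinite_range_cis: "infinite (range cis)"
proof
  assume "finite (range cis)"
  then have "finite (Im ` cis ` {0..1})" by (rule finite_subset[rotated, OF finite_imageI]) auto
  moreover have "Im ` cis ` {0..1} = sin ` {0..1}" by (auto simp: image_image)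
  moreover have "inj_on sin {0..1::real}"
    using sin_inj_pi pi_gt3 by (intro inj_onI) auto
  ultimately have "finite {0..1::real}" by (metis finite_imageD)
  then show False by (simp add: infinite_Icc)
qed

locale complex_structure =
  fixes J :: "'e::euclidean_space \<Rightarrow> 'e"
  assumes linear_J: "linear J" and J_J: "J (J v) = - v"
begin

text \<open>
  The rotations \<open>cos s + sin s J\<close> act on forms of type \<open>(p, q)\<close> by the character
  \<open>exp (\<i> s (p - q))\<close>, which separates the types.
\<close>

lemma Lambda_rotate:
  assumes "\<omega> \<in> Lambda J p q"
  shows "\<omega> (map (\<lambda>v. cos s *\<^sub>R v + sin s *\<^sub>R J v) vs) = cis s ^ p * cis (- s) ^ q * \<omega> vs"
  using assms unfolding Lambda_def
proof (induction rule: cspan_induct)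
  case (base f)
  then obtain as bs where f: "f = wedge (as @ bs)" "length as = p" "length bs = q"
    and ab: "set as \<subseteq> covectors_10 J" "set bs \<subseteq> covectors_01 J" by auto
  let ?R = "\<lambda>v. cos s *\<^sub>R v + sin s *\<^sub>R J v"
  have "a (?R v) = cis s * a v" if "a \<in> set as" for a v
    using that ab(1) by (auto simp: covectors_10_def linear_add linear_complex_scaleR cis_conv_exp
      exp_Euler algebra_simps cos_of_real sin_of_real)
  moreover have "b (?R v) = cis (- s) * b v" if "b \<in> set bs" for b v
    using that ab(2) by (auto simp: covectors_01_def linear_add linear_complex_scaleR cis_conv_exp
      exp_Euler exp_minus_Euler algebra_simps cos_of_real sin_of_real)
  ultimately have "map (\<lambda>a v. a (?R v)) (as @ bs)
      = map (\<lambda>a v. cis s * a v) as @ map (\<lambda>b v. cis (- s) * b v) bs"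
    by simp
  then show ?case unfolding f(1) wedge_map by (simp only: wedge_scale_append f)
qed (simp_all add: algebra_simps)

lemma type_decomposition_unique:
  assumes "\<And>i. i \<le> n \<Longrightarrow> c i \<in> Lambda J i (n - i)" "\<And>i. i \<le> n \<Longrightarrow> c' i \<in> Lambda J i (n - i)"
    and "\<And>vs. (\<Sum>i\<le>n. c i vs) = (\<Sum>i\<le>n. c' i vs)" and "i \<le> n"
  shows "c i = c' i"
proof
  fix vs
  define \<delta> where "\<delta> i = c i vs - c' i vs" for i
  \<comment> \<open>Rotation by s/2 acts on type (i, n - i) by \<open>cis (s/2)\<close> to the power
    2i - n. The extra factor \<open>cis (s/2) ^ n\<close> turns this into \<open>cis s ^ i\<close>,
    so the differences become the coefficients of a polynomial that vanishes on the unit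
    circle.\<close>
  have "(\<Sum>i\<le>n. \<delta> i * cis s ^ i) = 0" for s
  proof -
    let ?R = "\<lambda>v. cos (s/2) *\<^sub>R v + sin (s/2) *\<^sub>R J v"
    have "cis (s/2) ^ n * (cis (s/2) ^ i * cis (- (s/2)) ^ (n - i)) = cis s ^ i" if "i \<le> n" for i
    proof -
      have "cis (s/2) ^ n = cis (s/2) ^ i * cis (s/2) ^ (n - i)"
        using that by (simp flip: power_add)
      moreover have "cis (s/2) ^ (n - i) * cis (- (s/2)) ^ (n - i) = 1"
        by (simp flip: power_mult_distrib add: cis_mult)
      moreover have "cis (s/2) ^ i * cis (s/2) ^ i = cis s ^ i"
        by (simp flip: power_mult_distrib add: cis_mult)
      ultimately show ?thesis by (simp add: mult_ac)
    qed
    moreover have "c i (map ?R vs) - c' i (map ?R vs) = (cis (s/2) ^ i * cis (- (s/2)) ^ (n - i)) * \<delta> i"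
      if "i \<le> n" for i
      unfolding \<delta>_def right_diff_distrib Lambda_rotate[OF assms(1)[OF that]] Lambda_rotate[OF assms(2)[OF that]] ..
    ultimately have "(\<Sum>i\<le>n. \<delta> i * cis s ^ i)
        = (\<Sum>i\<le>n. cis (s/2) ^ n * (c i (map ?R vs) - c' i (map ?R vs)))"
      by (intro sum.cong refl) (simp add: mult.assoc[symmetric])
    also have "\<dots> = 0"
      using assms(3)[of "map ?R vs"] by (simp add: sum_subtractf flip: sum_distrib_left)
    finally show ?thesis .
  qed
  then have "range cis \<subseteq> {z. (\<Sum>i\<le>n. \<delta> i * z ^ i) = 0}" by auto
  then have "infinite {z. (\<Sum>i\<le>n. \<delta> i * z ^ i) = 0}"
    using infinite_range_cis finite_subset by blast
  then have "\<delta> i = 0" using polyfun_finite_roots[of \<delta> n] \<open>i \<le> n\<close> by blast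
  then show "c i vs = c' i vs" by (simp add: \<delta>_def)
qed

text \<open>By uniqueness the description in \<open>component\<close> is well defined, so any
  exhibited decomposition computes it.\<close>

lemma component_eqI:
  assumes "\<And>i. i \<le> p + q \<Longrightarrow> c i \<in> Lambda J i (p + q - i)"
    and "\<And>vs. \<omega> vs = (\<Sum>i\<le>p + q. c i vs)"
  shows "component J p q \<omega> = c p"
  unfolding component_def
proof (rule the_equality)
  show "\<exists>c'. (\<forall>i\<le>p + q. c' i \<in> Lambda J i (p + q - i)) \<and>
      (\<forall>vs. \<omega> vs = (\<Sum>i\<le>p + q. c' i vs)) \<and> c p = c' p"
    using assms by blast
next
  fix \<eta> assume "\<exists>c'. (\<forall>i\<le>p + q. c' i \<in> Lambda J i (p + q - i)) \<and>
      (\<forall>vs. \<omega> vs = (\<Sum>i\<le>p + q. c' i vs)) \<and> \<eta> = c' p"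
  then show "\<eta> = c p"
    using type_decomposition_unique[of "p + q" c _ p] assms by (metis le_add1)
qed

section \<open>Contraction with a vector and its image under J\<close>

lemma wedge_10_J:
  assumes "set as \<subseteq> covectors_10 J"
  shows "wedge as (J v # vs) = \<i> * wedge as (v # vs)"
  using assms
proof (induction as arbitrary: vs)
  case (Cons a as)
  have "a (J v) = \<i> * a v" using Cons.prems by (auto simp: covectors_10_def)
  then show ?case using Cons
    by (simp add: wedge_Cons alt_def sum.lessThan_Suc_shift sum_distrib_left algebra_simps
        del: sum.lessThan_Suc)
qed simp

lemma wedge_10_v_J:
  assumes "set as \<subseteq> covectors_10 J"
  shows "wedge as (v # J v # vs) = 0"
  using assms
proof (induction as arbitrary: vs)
  case (Cons a as)
  have "a (J v) = \<i> * a v" using Cons.prems by (auto simp: covectors_10_def)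
  then show ?case using Cons wedge_10_J[of as v]
    by (simp add: wedge_Cons alt_def sum.lessThan_Suc_shift del: sum.lessThan_Suc)
qed simp

text \<open>Feeding v or J v to b gives the same contribution, \<i> * b v times the value of the
  (1,0)-form. In all other terms both vectors remain in the (1,0)-form, which vanishes on such a
  pair. The formula recovers b from its wedge product.\<close>

lemma wedge_01_10:
  assumes "b \<in> covectors_01 J" "set as \<subseteq> covectors_10 J"
  shows "wedge (b # as) (v # J v # vs) = 2 * \<i> * b v * wedge as (v # vs)"
proof -
  have "b (J v) = - \<i> * b v" using assms(1) by (auto simp: covectors_01_def)
  then show ?thesis using wedge_10_J[OF assms(2)] wedge_10_v_J[OF assms(2)]
    by (simp add: wedge_Cons alt_def sum.lessThan_Suc_shift del: sum.lessThan_Suc)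
qed

lemma covectors_01_add: "a \<in> covectors_01 J \<Longrightarrow> b \<in> covectors_01 J \<Longrightarrow> (\<lambda>v. a v + b v) \<in> covectors_01 J"
  by (auto simp: covectors_01_def algebra_simps linear_compose_add)

lemma covectors_01_scale: "a \<in> covectors_01 J \<Longrightarrow> (\<lambda>v. c * a v) \<in> covectors_01 J"
  by (auto simp: covectors_01_def algebra_simps linear_add linear_complex_scaleR scaleR_conv_of_real intro!: linearI)

lemma covectors_10_add: "a \<in> covectors_10 J \<Longrightarrow> b \<in> covectors_10 J \<Longrightarrow> (\<lambda>v. a v + b v) \<in> covectors_10 J"
  by (auto simp: covectors_10_def algebra_simps linear_compose_add)

lemma covectors_10_scale: "a \<in> covectors_10 J \<Longrightarrow> (\<lambda>v. c * a v) \<in> covectors_10 J"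
  by (auto simp: covectors_10_def algebra_simps linear_add linear_complex_scaleR scaleR_conv_of_real intro!: linearI)

lemma covectors_01_zero: "(\<lambda>_. 0) \<in> covectors_01 J"
  by (auto simp: covectors_01_def intro!: linearI)

lemma covectors_10_zero: "(\<lambda>_. 0) \<in> covectors_10 J"
  by (auto simp: covectors_10_def intro!: linearI)

lemma cnj_covectors_10: "a \<in> covectors_10 J \<Longrightarrow> (\<lambda>v. cnj (a v)) \<in> covectors_01 J"
  by (auto simp: covectors_10_def covectors_01_def linear_add linear_complex_scaleR scaleR_conv_of_real intro!: linearI)

text \<open>When D is the differential of a function, this is its Dolbeault derivative.\<close>

lemma linear_part_01:
  assumes "linear D"
  shows "(\<lambda>v. (D v + \<i> * D (J v)) / 2) \<in> covectors_01 J"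
  using assms linear_J
  by (auto simp: covectors_01_def linear_add linear_cmul linear_neg J_J scaleR_conv_of_real
      field_simps intro!: linearI)

lemma linear_part_10:
  assumes "linear D"
  shows "(\<lambda>v. (D v - \<i> * D (J v)) / 2) \<in> covectors_10 J"
  using assms linear_J
  by (auto simp: covectors_10_def linear_add linear_cmul linear_neg J_J scaleR_conv_of_real
      field_simps intro!: linearI)

end

section \<open>Complex coframes\<close>

text \<open>The data at a single tangent space. The \<open>e k\<close> are dual to the forms over
  the complex numbers, and together with their images under J they span over the reals. As the forms
  separate vectors, identities for J can be tested on them, which makes J a complex
  structure.\<close>

locale coframe =
  fixes J :: "'e::euclidean_space \<Rightarrow> 'e" and \<phi> :: "nat \<Rightarrow> 'e \<Rightarrow> complex" and e :: "nat \<Rightarrow> 'e" and d :: nat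
  assumes linear_form: "j < d \<Longrightarrow> linear (\<phi> j)"
    and form_J: "j < d \<Longrightarrow> \<phi> j (J v) = \<i> * \<phi> j v"
    and form_dual: "j < d \<Longrightarrow> k < d \<Longrightarrow> \<phi> j (e k) = (if j = k then 1 else 0)"
    and separating: "(\<And>j. j < d \<Longrightarrow> \<phi> j v = 0) \<Longrightarrow> v = 0"
begin

lemma form_eqI:
  assumes "\<And>j. j < d \<Longrightarrow> \<phi> j u = \<phi> j v"
  shows "u = v"
  using separating[of "u - v"] assms linear_form by (simp add: linear_diff)

sublocale complex_structure J
proof (rule complex_structure.intro)
  show "linear J"
    by (rule linearI; rule form_eqI)
      (simp_all add: form_J linear_form linear_add linear_complex_scaleR algebra_simps)
  show "J (J v) = - v" for v
    by (rule form_eqI) (simp add: form_J linear_form linear_neg)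
qed

lemma form_10: "j < d \<Longrightarrow> \<phi> j \<in> covectors_10 J"
  by (simp add: covectors_10_def linear_form form_J)

lemma form_expansion: "v = (\<Sum>j<d. Re (\<phi> j v) *\<^sub>R e j + Im (\<phi> j v) *\<^sub>R J (e j))"
proof (rule form_eqI)
  fix k assume k: "k < d"
  have "\<phi> k (Re (\<phi> j v) *\<^sub>R e j + Im (\<phi> j v) *\<^sub>R J (e j)) = (if j = k then \<phi> k v else 0)"
    if "j < d" for j
    using k that linear_form[OF k]
    by (simp add: linear_add linear_complex_scaleR form_J form_dual complex_eq_iff)
  then show "\<phi> k v = \<phi> k (\<Sum>j<d. Re (\<phi> j v) *\<^sub>R e j + Im (\<phi> j v) *\<^sub>R J (e j))"
    using k linear_form[OF k] by (simp add: linear_sum)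
qed

lemma covectors_10_eq: "covectors_10 J = cspan (\<phi> ` {..<d})"
proof
  show "cspan (\<phi> ` {..<d}) \<subseteq> covectors_10 J"
  proof
    fix a assume "a \<in> cspan (\<phi> ` {..<d})"
    then show "a \<in> covectors_10 J"
      by (induction rule: cspan_induct)
        (auto intro: covectors_10_zero covectors_10_add covectors_10_scale form_10)
  qed
  show "covectors_10 J \<subseteq> cspan (\<phi> ` {..<d})"
  proof
    fix a assume a: "a \<in> covectors_10 J"
    have "a v = (\<Sum>j<d. a (e j) * \<phi> j v)" for v
    proof -
      have "a v = a (\<Sum>j<d. Re (\<phi> j v) *\<^sub>R e j + Im (\<phi> j v) *\<^sub>R J (e j))"
        using form_expansion[of v] by simp
      also have "\<dots> = (\<Sum>j<d. a (e j) * \<phi> j v)"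
        using a by (auto simp: covectors_10_def linear_sum linear_add linear_complex_scaleR
            complex_eq_iff algebra_simps intro!: sum.cong)
      finally show ?thesis .
    qed
    then have "a = (\<lambda>v. \<Sum>j<d. a (e j) * \<phi> j v)" by blast
    also have "\<dots> \<in> cspan (\<phi> ` {..<d})"
      by (intro cspan_sum cspan_scale cspan_base) auto
    finally show "a \<in> cspan (\<phi> ` {..<d})" .
  qed
qed

lemma covectors_01_eqI:
  assumes "a \<in> covectors_01 J" "b \<in> covectors_01 J" "\<And>k. k < d \<Longrightarrow> a (e k) = b (e k)"
  shows "a = b"
proof
  fix v
  have *: "c v = (\<Sum>j<d. c (e j) * cnj (\<phi> j v))" if "c \<in> covectors_01 J" for c
  proof -
    have "c v = c (\<Sum>j<d. Re (\<phi> j v) *\<^sub>R e j + Im (\<phi> j v) *\<^sub>R J (e j))"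
      using form_expansion[of v] by simp
    also have "\<dots> = (\<Sum>j<d. c (e j) * cnj (\<phi> j v))"
      using that by (auto simp: covectors_01_def linear_sum linear_add linear_complex_scaleR
          complex_eq_iff algebra_simps intro!: sum.cong)
    finally show ?thesis .
  qed
  show "a v = b v" unfolding *[OF assms(1)] *[OF assms(2)] using assms(3) by simp
qed

section \<open>The top form as a basis of the canonical line\<close>

definition top_form :: "'e list \<Rightarrow> complex" where
  "top_form = wedge (map \<phi> [0..<d])"

lemma forms_10: "set (map \<phi> [0..<d]) \<subseteq> covectors_10 J"
  using form_10 by auto

lemma distinct_forms: "distinct (map \<phi> [0..<d])"
  using form_dual unfolding distinct_map by (auto simp: inj_on_def) (metis zero_neq_one)

lemma wedge_forms_dual:
  assumes "distinct ks" "set ks \<subseteq> {..<d}"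
  shows "wedge (map \<phi> ks) (map e ks) = 1"
proof -
  have dual: "(map \<phi> ks ! i) (map e ks ! k) = (if i = k then 1 else 0)"
    if "i < length ks" "k < length ks" for i k
  proof -
    have "ks ! i < d" "ks ! k < d" using assms(2) that nth_mem by fastforce+
    then show ?thesis using assms(1) that by (simp add: form_dual nth_eq_iff_index_eq)
  qed
  show ?thesis by (subst wedge_diagonal) (use dual in auto)
qed

lemma Lambda_top: "Lambda J d 0 = cspan {top_form}"
proof
  show "Lambda J d 0 \<subseteq> cspan {top_form}"
    unfolding Lambda_def
  proof (rule cspan_subset, rule subsetI)
    fix \<omega>
    assume "\<omega> \<in> {wedge (as @ bs) | as bs. length as = d \<and> set as \<subseteq> covectors_10 J \<and>
        length bs = 0 \<and> set bs \<subseteq> covectors_01 J}"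
    then obtain as where \<omega>: "\<omega> = wedge as" and "length as = d" "set as \<subseteq> covectors_10 J" by auto
    then have "wedge as \<in> cspan {wedge (map \<phi> [0..<d])}"
      using distinct_forms by (intro wedge_top_cspan) (auto simp: covectors_10_eq atLeast0LessThan)
    then show "\<omega> \<in> cspan {top_form}" by (simp add: top_form_def \<omega>)
  qed
  show "cspan {top_form} \<subseteq> Lambda J d 0"
    unfolding Lambda_def
  proof (rule cspan_subset)
    show "{top_form} \<subseteq> cspan {wedge (as @ bs) | as bs. length as = d \<and> set as \<subseteq> covectors_10 J \<and>
        length bs = 0 \<and> set bs \<subseteq> covectors_01 J}"
      using forms_10 by (auto simp: top_form_def intro!: cspan_base exI[of _ "map \<phi> [0..<d]"])
  qed
qed

lemma Lambda_topE:
  assumes "\<omega> \<in> Lambda J d 0"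
  obtains c where "\<omega> = (\<lambda>us. c * top_form us)"
  using assms by (auto simp: Lambda_top cspan_singleton)

lemma tensor_01_Lambda_eq:
  "tensor_01_Lambda J d = {\<lambda>(v, us). b v * top_form us | b. b \<in> covectors_01 J}"
proof
  show "tensor_01_Lambda J d \<subseteq> {\<lambda>(v, us). b v * top_form us | b. b \<in> covectors_01 J}"
  proof
    fix \<theta> assume "\<theta> \<in> tensor_01_Lambda J d"
    then have "\<exists>b \<in> covectors_01 J. \<theta> = (\<lambda>(v, us). b v * top_form us)"
      unfolding tensor_01_Lambda_def
    proof (induction rule: cspan_induct)
      case zero
      show ?case using covectors_01_zero by (auto intro!: bexI[of _ "\<lambda>_. 0"])
    next
      case (add f g)
      then obtain a b where "a \<in> covectors_01 J" "b \<in> covectors_01 J"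
        "f = (\<lambda>(v, us). a v * top_form us)" "g = (\<lambda>(v, us). b v * top_form us)" by blast
      then show ?case
        by (intro bexI[of _ "\<lambda>v. a v + b v"] covectors_01_add) (simp_all add: split_def distrib_right)
    next
      case (scale c f)
      then obtain b where "b \<in> covectors_01 J" "f = (\<lambda>(v, us). b v * top_form us)" by blast
      then show ?case
        by (intro bexI[of _ "\<lambda>v. c * b v"] covectors_01_scale) (simp_all only: split_def mult.assoc)
    next
      case (base f)
      then obtain b c where "b \<in> covectors_01 J" "f = (\<lambda>(v, us). b v * (c * top_form us))"
        by (auto simp: Lambda_top cspan_singleton)
      then show ?case
        by (intro bexI[of _ "\<lambda>v. c * b v"] covectors_01_scale)
          (simp_all only: split_def mult.assoc mult.left_commute[of "b _" c])
    qed
    then show "\<theta> \<in> {\<lambda>(v, us). b v * top_form us | b. b \<in> covectors_01 J}" by blast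
  qed
  show "{\<lambda>(v, us). b v * top_form us | b. b \<in> covectors_01 J} \<subseteq> tensor_01_Lambda J d"
    unfolding tensor_01_Lambda_def Lambda_top by (blast intro: cspan_base)
qed

text \<open>This is the uniqueness behind the description in \<open>dbar\<close>.\<close>

lemma wedge_01_top_inj:
  assumes "a \<in> covectors_01 J" "b \<in> covectors_01 J"
    and eq: "wedge (a # map \<phi> [0..<d]) = wedge (b # map \<phi> [0..<d])"
  shows "a = b"
proof (rule covectors_01_eqI[OF assms(1,2)])
  fix k assume "k < d"
  \<comment> \<open>The test list is e_k, J e_k, followed by the other dual vectors. By
    \<open>wedge_01_10\<close> it yields 2 \<i> * a (e_k) times the top form on the reordered dual
    vectors, which is a sign.\<close>
  then obtain xs ys where split: "[0..<d] = xs @ k # ys" by (metis atLeastLessThan_iff set_upt split_list zero_le)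
  have "distinct (k # xs @ ys)" using distinct_upt[of 0 d] unfolding split by auto
  moreover have "set (k # xs @ ys) \<subseteq> {..<d}"
    using arg_cong[OF split, of set] by auto
  ultimately have "wedge (map \<phi> (k # xs @ ys)) (map e (k # xs @ ys)) = 1"
    by (rule wedge_forms_dual)
  then have "wedge (map \<phi> [0..<d]) (e k # map e (xs @ ys)) \<noteq> 0"
    using wedge_move[of "map \<phi> xs" "\<phi> k" "map \<phi> ys"] by (simp add: split)
  then show "a (e k) = b (e k)"
    using fun_cong[OF eq, of "e k # J (e k) # map e (xs @ ys)"]
      wedge_01_10[OF assms(1) forms_10] wedge_01_10[OF assms(2) forms_10]
    by simp
qed

lemma wedge_10_top:
  assumes "a \<in> covectors_10 J"
  shows "wedge (a # map \<phi> [0..<d]) vs = 0"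
  using assms unfolding covectors_10_eq
proof (induction rule: cspan_induct)
  case (base f)
  then show ?case by (subst wedge_repeat) auto
qed (simp_all add: wedge_head_zero wedge_head_add wedge_head_scale)

text \<open>Resolves both descriptions in \<open>dbar\<close> at once. The summand \<omega> of type
  (d-1,2) measures the failure of integrability, and \<open>component\<close> discards it.\<close>

lemma dbar_eqI:
  assumes "Jf x = J" "0 < d"
    and ext: "\<And>vs. ext_deriv s x vs = wedge (b # map \<phi> [0..<d]) vs + \<omega> vs"
    and b: "b \<in> covectors_01 J" and \<omega>: "\<omega> \<in> Lambda J (d - 1) 2"
  shows "dbar d Jf s x = (\<lambda>(v, us). b v * top_form us)"
proof -
  define c where "c i = (if i = d then wedge (b # map \<phi> [0..<d]) else if i = d - 1 then \<omega> else (\<lambda>_. 0))" for i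
  have "component J d 1 (ext_deriv s x) = c d"
  proof (rule component_eqI)
    fix i assume "i \<le> d + 1"
    have "wedge (b # map \<phi> [0..<d]) \<in> Lambda J d 1"
      by (rule Lambda_mset[of _ "map \<phi> [0..<d]" "[b]"]) (use forms_10 b in auto)
    then show "c i \<in> Lambda J i (d + 1 - i)"
      using \<omega> \<open>0 < d\<close> by (auto simp: c_def numeral_2_eq_2 Suc_diff_le) (auto simp: Lambda_def cspan_zero)
  next
    fix vs
    have "(\<Sum>i\<le>d + 1. c i vs) = (\<Sum>i\<in>{d, d - 1}. c i vs)"
      by (rule sum.mono_neutral_right) (auto simp: c_def)
    then show "ext_deriv s x vs = (\<Sum>i\<le>d + 1. c i vs)"
      using \<open>0 < d\<close> by (cases d) (simp_all add: c_def ext)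
  qed
  then have comp: "component J d 1 (ext_deriv s x) = wedge (b # map \<phi> [0..<d])" by (simp add: c_def)
  have alt_top: "alt (\<lambda>(v, us). a v * top_form us) = wedge (a # map \<phi> [0..<d])" for a
    by (simp add: top_form_def fun_eq_iff wedge_Cons)
  show ?thesis
    unfolding dbar_def assms(1) comp
  proof (rule the_equality)
    show "(\<lambda>(v, us). b v * top_form us) \<in> tensor_01_Lambda J d \<and>
        alt (\<lambda>(v, us). b v * top_form us) = wedge (b # map \<phi> [0..<d])"
      using b by (auto simp: tensor_01_Lambda_eq alt_top)
  next
    fix \<theta> assume "\<theta> \<in> tensor_01_Lambda J d \<and> alt \<theta> = wedge (b # map \<phi> [0..<d])"
    then obtain a where a: "a \<in> covectors_01 J" and \<theta>: "\<theta> = (\<lambda>(v, us). a v * top_form us)"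
      and "alt \<theta> = wedge (b # map \<phi> [0..<d])" by (auto simp: tensor_01_Lambda_eq)
    then have "a = b" using wedge_01_top_inj[OF a b] by (simp add: alt_top)
    then show "\<theta> = (\<lambda>(v, us). b v * top_form us)" using \<theta> by simp
  qed
qed

lemma tensor_replicate_top:
  assumes "length es = r" "set es \<subseteq> Lambda J d 0"
  shows "tensor es \<in> cspan {tensor (replicate r top_form)}"
proof -
  have "\<forall>i<r. \<exists>c. es ! i = (\<lambda>us. c * top_form us)"
    using assms by (metis Lambda_topE nth_mem subsetD)
  then obtain c where "\<And>i. i < r \<Longrightarrow> es ! i = (\<lambda>us. c i * top_form us)" by metis
  then have "tensor es = (\<lambda>uss. (\<Prod>i<r. c i) * tensor (replicate r top_form) uss)"
    using assms(1) by (auto simp: tensor_def fun_eq_iff prod.distrib)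
  then show ?thesis by (auto simp: cspan_singleton)
qed

lemma Lambda_power_eq: "Lambda_power J d r = cspan {tensor (replicate r top_form)}"
proof
  show "Lambda_power J d r \<subseteq> cspan {tensor (replicate r top_form)}"
    unfolding Lambda_power_def by (rule cspan_subset) (use tensor_replicate_top in blast)
  have "top_form \<in> Lambda J d 0" unfolding Lambda_top by (rule cspan_base) simp
  then show "cspan {tensor (replicate r top_form)} \<subseteq> Lambda_power J d r"
    unfolding Lambda_power_def
    by (intro cspan_subset) (auto intro!: cspan_base exI[of _ "replicate r top_form"])
qed

end

section \<open>The Nakamura coframe\<close>

lemma has_derivative_alt:
  assumes "\<And>i. i < length vs \<Longrightarrow>
      ((\<lambda>y. h y (vs ! i, take i vs @ drop (Suc i) vs)) has_derivative
       (\<lambda>v. h' v (vs ! i, take i vs @ drop (Suc i) vs))) F"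
  shows "((\<lambda>y. alt (h y) vs) has_derivative (\<lambda>v. alt (h' v) vs)) F"
  unfolding alt_def by (auto intro!: has_derivative_sum has_derivative_mult_right assms)

text \<open>Tailored to forms whose coefficients depend on one real coordinate: every derivative is
  the same scalar \<open>c v\<close> times a covector, so this scalar leaves the Leibniz sum and
  later plays the part of dx.\<close>

lemma has_derivative_wedge:
  fixes f :: "nat \<Rightarrow> 'x::real_normed_vector \<Rightarrow> 'e \<Rightarrow> complex"
  assumes "\<And>j w. j \<in> set js \<Longrightarrow> ((\<lambda>y. f j y w) has_derivative (\<lambda>v. c v * \<eta> j w)) (at g)"
  shows "((\<lambda>y. wedge (map (\<lambda>j. f j y) js) us) has_derivative
      (\<lambda>v. c v * (\<Sum>k<length js. wedge ((map (\<lambda>j. f j g) js)[k := \<eta> (js ! k)]) us))) (at g)"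
  using assms
proof (induction js arbitrary: us)
  case (Cons j js)
  let ?S = "\<lambda>us. \<Sum>k<length js. wedge ((map (\<lambda>j. f j g) js)[k := \<eta> (js ! k)]) us"
  have *: "((\<lambda>y. alt (\<lambda>(w, ws). f j y w * wedge (map (\<lambda>j. f j y) js) ws) us) has_derivative
      (\<lambda>v. alt (\<lambda>(w, ws). f j g w * (c v * ?S ws) + c v * \<eta> j w * wedge (map (\<lambda>j. f j g) js) ws) us)) (at g)"
    by (rule has_derivative_alt) (auto intro!: has_derivative_mult Cons)
  have "alt (\<lambda>(w, ws). f j g w * (c v * ?S ws) + c v * \<eta> j w * wedge (map (\<lambda>j. f j g) js) ws) us
      = c v * (\<Sum>k<length (j # js). wedge ((map (\<lambda>j. f j g) (j # js))[k := \<eta> ((j # js) ! k)]) us)" for v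
  proof -
    have "(\<lambda>(w, ws). f j g w * (c v * ?S ws) + c v * \<eta> j w * wedge (map (\<lambda>j. f j g) js) ws)
        = (\<lambda>p. c v * ((case p of (w, ws) \<Rightarrow> \<eta> j w * wedge (map (\<lambda>j. f j g) js) ws)
             + (\<Sum>k<length js. case p of (w, ws) \<Rightarrow> f j g w * wedge ((map (\<lambda>j. f j g) js)[k := \<eta> (js ! k)]) ws)))"
      by (auto simp: fun_eq_iff algebra_simps sum_distrib_left)
    then show ?thesis
      by (simp add: alt_scale alt_add alt_sum wedge_Cons sum.lessThan_Suc_shift del: sum.lessThan_Suc)
  qed
  then show ?case using * by (simp add: wedge_Cons)
qed simp

text \<open>The unit disc makes "t sufficiently small" concrete: there the common denominator of
  \<alpha> and \<beta> is negative, and \<beta> has no zero because its numerator vanishes only at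
  the boundary point (1, 0).\<close>

locale nakamura_forms =
  fixes l1 l2 :: real and t :: "real^2"
  assumes norm_t: "norm t < 1"
begin

abbreviation \<alpha> :: real where "\<alpha> \<equiv> alpha t"
abbreviation \<beta> :: real where "\<beta> \<equiv> beta t"
abbreviation \<phi> :: "nat \<Rightarrow> CxC4 \<Rightarrow> CxC4 \<Rightarrow> complex" where "\<phi> \<equiv> phi l1 l2 t"
abbreviation \<J> :: "CxC4 \<Rightarrow> CxC4 \<Rightarrow> CxC4" where "\<J> \<equiv> J_nak l1 l2 t"

lemma beta_nonzero: "\<beta> \<noteq> 0"
proof -
  have "(t $ 1)^2 + (t $ 2)^2 = (norm t)^2"
    by (simp add: norm_vec_def L2_set_def sum_2)
  also have "\<dots> < 1" using norm_t by (simp add: power_less_one_iff abs_square_less_1)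
  finally have *: "(t $ 1)^2 + (t $ 2)^2 < 1" .
  then have "(1 - t $ 1)^2 + (t $ 2)^2 \<noteq> 0" by (auto simp: sum_power2_eq_zero_iff)
  then show ?thesis using * by (simp add: beta_def)
qed

lemma phi_simps:
  "\<phi> 0 g w = fst w"
  "\<phi> 1 g w = Complex (exp (- l1 * Re (fst g)) * Re (snd w $ 1)) (exp (l1 * Re (fst g)) * Re (snd w $ 2))"
  "\<phi> 2 g w = Complex (exp (- l1 * Re (fst g)) * Im (snd w $ 1)) (exp (l1 * Re (fst g)) * Im (snd w $ 2))"
  "\<phi> 3 g w = Complex (exp (- l2 * Re (fst g)) * Re (snd w $ 3)) (exp (l2 * Re (fst g)) * Re (snd w $ 4))"
  "\<phi> 4 g w = Complex (exp (- l2 * Re (fst g)) * Im (snd w $ 3))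
     (- (\<alpha> * (exp (- l2 * Re (fst g)) * Im (snd w $ 3)) + \<beta> * (exp (l2 * Re (fst g)) * Im (snd w $ 4))))"
  by (simp_all add: phi_def coframe_E_def coframe_F_def complex_eq_iff numeral_eq_Suc)

lemma less_5_cases: "j < (5::nat) \<longleftrightarrow> j = 0 \<or> j = 1 \<or> j = 2 \<or> j = 3 \<or> j = 4"
  by auto

text \<open>The inverse of the coframe at g: the tangent vector on which the forms take prescribed
  values. Division by \<beta> solves \<phi>^4 for F^4. Values multiplied by \<i> give J, and unit
  values give the dual vectors.\<close>

definition of_forms :: "CxC4 \<Rightarrow> (nat \<Rightarrow> complex) \<Rightarrow> CxC4" where
  "of_forms g a = (a 0, \<chi> j.
     if j = 1 then Complex (exp (l1 * Re (fst g)) * Re (a 1)) (exp (l1 * Re (fst g)) * Re (a 2))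
     else if j = 2 then Complex (exp (- l1 * Re (fst g)) * Im (a 1)) (exp (- l1 * Re (fst g)) * Im (a 2))
     else if j = 3 then Complex (exp (l2 * Re (fst g)) * Re (a 3)) (exp (l2 * Re (fst g)) * Re (a 4))
     else Complex (exp (- l2 * Re (fst g)) * Im (a 3))
       (exp (- l2 * Re (fst g)) * (- (Im (a 4) + \<alpha> * Re (a 4)) / \<beta>)))"

lemma phi_of_forms: "j < 5 \<Longrightarrow> \<phi> j g (of_forms g a) = a j"
  using beta_nonzero unfolding less_5_cases
  by (elim disjE; simp only: phi_simps)
    (simp_all add: of_forms_def complex_eq_iff mult.assoc[symmetric] flip: exp_add)

lemma phi_separating:
  assumes "\<And>j. j < 5 \<Longrightarrow> \<phi> j g v = 0"
  shows "v = 0"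
proof -
  have "\<phi> 0 g v = 0" "\<phi> 1 g v = 0" "\<phi> 2 g v = 0" "\<phi> 3 g v = 0" "\<phi> 4 g v = 0" using assms by auto
  then show ?thesis unfolding phi_simps using beta_nonzero
    by (auto simp: prod_eq_iff vec_eq_iff forall_4 complex_eq_iff)
qed

lemma linear_phi: "j < 5 \<Longrightarrow> linear (\<phi> j g)"
  unfolding less_5_cases
  by (elim disjE; intro linearI; simp only: phi_simps)
    (simp_all add: complex_eq_iff algebra_simps)

lemma coframe_of_forms:
  "coframe (\<lambda>w. of_forms g (\<lambda>j. \<i> * \<phi> j g w)) (\<lambda>j. \<phi> j g) (\<lambda>k. of_forms g (\<lambda>j. if j = k then 1 else 0)) 5"
  by (rule coframe.intro, simp_all only: linear_phi phi_of_forms) (rule phi_separating)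

lemma J_nak_eq: "\<J> g = (\<lambda>w. of_forms g (\<lambda>j. \<i> * \<phi> j g w))"
proof -
  interpret coframe "\<lambda>w. of_forms g (\<lambda>j. \<i> * \<phi> j g w)" "\<lambda>j. \<phi> j g"
    "\<lambda>k. of_forms g (\<lambda>j. if j = k then 1 else 0)" 5
    by (rule coframe_of_forms)
  have *: "(\<lambda>j. \<phi> j g) ` {..<5} = {\<phi> j g | j. j \<le> 4}" by force
  show ?thesis
    unfolding J_nak_def
  proof (rule the_equality)
    show "linear (\<lambda>w. of_forms g (\<lambda>j. \<i> * \<phi> j g w)) \<and>
        (\<forall>w. of_forms g (\<lambda>j. \<i> * \<phi> j g (of_forms g (\<lambda>j. \<i> * \<phi> j g w))) = - w) \<and>
        covectors_10 (\<lambda>w. of_forms g (\<lambda>j. \<i> * \<phi> j g w)) = cspan {\<phi> j g | j. j \<le> 4}"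
      using linear_J J_J covectors_10_eq * by auto
  next
    fix J assume J: "linear J \<and> (\<forall>w. J (J w) = - w) \<and> covectors_10 J = cspan {\<phi> j g | j. j \<le> 4}"
    show "J = (\<lambda>w. of_forms g (\<lambda>j. \<i> * \<phi> j g w))"
    proof (rule ext, rule form_eqI)
      fix w and j :: nat assume "j < 5"
      then have "\<phi> j g \<in> covectors_10 J" using J by (auto intro!: cspan_base)
      then show "\<phi> j g (J w) = \<phi> j g (of_forms g (\<lambda>j. \<i> * \<phi> j g w))"
        unfolding phi_of_forms[OF \<open>j < 5\<close>] covectors_10_def mem_Collect_eq by blast
    qed
  qed
qed

sublocale coframe "\<J> g" "\<lambda>j. \<phi> j g" "\<lambda>k. of_forms g (\<lambda>j. if j = k then 1 else 0)" 5 for g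
  using coframe_of_forms unfolding J_nak_eq .

definition \<Omega> :: "CxC4 \<Rightarrow> CxC4 list \<Rightarrow> complex" where
  "\<Omega> g = wedge (map (\<lambda>j. \<phi> j g) [0..<5])"

lemma top_form_eq: "top_form g = \<Omega> g"
  by (simp add: top_form_def \<Omega>_def)

lemma fst_J: "fst (\<J> g w) = \<i> * fst w"
  using form_J[of 0 g w] by (simp add: phi_simps)

lemma J_base: "\<J> g (z, 0) = (\<i> * z, 0)"
proof (rule form_eqI[of g])
  fix j :: nat assume j: "j < 5"
  show "\<phi> j g (\<J> g (z, 0)) = \<phi> j g (\<i> * z, 0)"
    using j unfolding form_J[OF j] less_5_cases
    by (elim disjE; simp only: phi_simps) (simp_all add: complex_eq_iff)
qed

lemma phi_Re_cong: "Re (fst g) = Re (fst g') \<Longrightarrow> \<phi> j g = \<phi> j g'"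
  by (simp add: phi_def coframe_E_def coframe_F_def fun_eq_iff)

text \<open>J is constant along the fibres of the projection to z, so complex lines inside a fibre
  are holomorphic curves. The fibrewise use of Liouville's theorem rests on this.\<close>

lemma J_Re_cong: "Re (fst g) = Re (fst g') \<Longrightarrow> \<J> g = \<J> g'"
  unfolding J_nak_def using phi_Re_cong[of g g'] by simp

text \<open>The x-derivative of \<phi>^j, so that d\<phi>^j = dx \<and> \<open>dphi j\<close>. The
  last case rewrites -l2 E - \<i>(-\<alpha> l2 E + \<beta> l2 F) by means of 2E = \<phi>^4 + cnj
  \<phi>^4 and -2\<i>(\<alpha> E + \<beta> F) = \<phi>^4 - cnj \<phi>^4, where E = E^4 and F =
  F^4.\<close>

definition dphi :: "nat \<Rightarrow> CxC4 \<Rightarrow> CxC4 \<Rightarrow> complex" where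
  "dphi j g w = (if j = 0 then 0 else if j < 3 then - of_real l1 * cnj (\<phi> j g w)
     else if j = 3 then - of_real l2 * cnj (\<phi> j g w)
     else (\<i> * of_real (\<alpha> * l2)) * \<phi> j g w + (- of_real l2 * (1 - \<i> * of_real \<alpha>)) * cnj (\<phi> j g w))"

lemma has_derivative_Complex:
  "(f has_derivative f') F \<Longrightarrow> (h has_derivative h') F \<Longrightarrow>
     ((\<lambda>x. Complex (f x) (h x)) has_derivative (\<lambda>x. Complex (f' x) (h' x))) F"
  unfolding Complex_eq by (auto intro!: derivative_eq_intros)

lemma phi_has_derivative:
  assumes "j < 5"
  shows "((\<lambda>y. \<phi> j y w) has_derivative (\<lambda>v. of_real (Re (fst v)) * dphi j g w)) (at g)"
proof -
  have exp: "((\<lambda>y. exp (c * Re (fst y)) * k) has_derivative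
      (\<lambda>v. Re (fst v) * (c * exp (c * Re (fst g)) * k))) (at g)" for c k :: real
    by (auto intro!: derivative_eq_intros)
  consider "j = 0" | "j = 1" | "j = 2" | "j = 3" | "j = 4" using assms by linarith
  then show ?thesis
  proof cases
    case 1
    then show ?thesis by (simp add: phi_simps dphi_def)
  next
    case 2
    show ?thesis unfolding 2 phi_simps
      by (rule has_derivative_eq_rhs, rule has_derivative_Complex[OF exp exp])
        (simp add: dphi_def phi_simps[unfolded One_nat_def] complex_eq_iff fun_eq_iff)
  next
    case 3
    show ?thesis unfolding 3 phi_simps
      by (rule has_derivative_eq_rhs, rule has_derivative_Complex[OF exp exp])
        (simp add: dphi_def phi_simps complex_eq_iff fun_eq_iff)
  next
    case 4
    show ?thesis unfolding 4 phi_simps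
      by (rule has_derivative_eq_rhs, rule has_derivative_Complex[OF exp exp])
        (simp add: dphi_def phi_simps complex_eq_iff fun_eq_iff)
  next
    case 5
    have "((\<lambda>y. - (\<alpha> * (exp (- l2 * Re (fst y)) * Im (snd w $ 3)) + \<beta> * (exp (l2 * Re (fst y)) * Im (snd w $ 4))))
        has_derivative (\<lambda>v. - (\<alpha> * (Re (fst v) * (- l2 * exp (- l2 * Re (fst g)) * Im (snd w $ 3)))
          + \<beta> * (Re (fst v) * (l2 * exp (l2 * Re (fst g)) * Im (snd w $ 4)))))) (at g)"
      by (intro has_derivative_minus has_derivative_add has_derivative_mult_right exp)
    from has_derivative_Complex[OF exp this] show ?thesis unfolding 5 phi_simps
      by (rule has_derivative_eq_rhs)
        (simp add: dphi_def phi_simps complex_eq_iff fun_eq_iff algebra_simps)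
  qed
qed

lemma Omega_has_derivative:
  "((\<lambda>y. \<Omega> y us) has_derivative
     (\<lambda>v. of_real (Re (fst v)) * (\<Sum>k<5. wedge ((map (\<lambda>j. \<phi> j g) [0..<5])[k := dphi k g]) us))) (at g)"
proof -
  have "((\<lambda>y. \<Omega> y us) has_derivative (\<lambda>v. of_real (Re (fst v)) *
      (\<Sum>k<length [0..<5]. wedge ((map (\<lambda>j. \<phi> j g) [0..<5])[k := dphi ([0..<5] ! k) g]) us))) (at g)"
    unfolding \<Omega>_def by (rule has_derivative_wedge) (simp add: phi_has_derivative)
  moreover have "(\<Sum>k<length [0..<5]. wedge ((map (\<lambda>j. \<phi> j g) [0..<5])[k := dphi ([0..<5] ! k) g]) us)
      = (\<Sum>k<5. wedge ((map (\<lambda>j. \<phi> j g) [0..<5])[k := dphi k g]) us)"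
    by (rule sum.cong) auto
  ultimately show ?thesis by simp
qed

lemma dphi_01: "0 < j \<Longrightarrow> j < 4 \<Longrightarrow> dphi j g \<in> covectors_01 (\<J> g)"
proof -
  assume "0 < j" "j < 4"
  then have "dphi j g = (\<lambda>w. (if j < 3 then - of_real l1 else - of_real l2) * cnj (\<phi> j g w))"
    by (simp add: dphi_def fun_eq_iff)
  moreover have "\<phi> j g \<in> covectors_10 (\<J> g)" using \<open>j < 4\<close> by (intro form_10) simp
  ultimately show ?thesis by (simp only: covectors_01_scale cnj_covectors_10)
qed

lemma upt_5: "[0..<5] = [0, 1, 2, 3, 4::nat]"
  by (simp add: upt_rec)

text \<open>Sorts the terms of d\<Omega> by the number of conjugate factors. Only the \<phi>^4
  component of \<open>dphi 4\<close> restores a full set of (1,0)-factors.\<close>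

lemma dOmega:
  "\<exists>\<omega> \<in> Lambda (\<J> g) 4 2. \<forall>vs.
     (\<Sum>k<5. wedge ((\<lambda>v. of_real (Re (fst v))) # (map (\<lambda>j. \<phi> j g) [0..<5])[k := dphi k g]) vs)
       = \<i> * of_real (\<alpha> * l2) / 2 * wedge ((\<lambda>v. cnj (fst v)) # map (\<lambda>j. \<phi> j g) [0..<5]) vs + \<omega> vs"
proof -
  define f where "f j = \<phi> j g" for j
  define f' where "f' = (\<lambda>v::CxC4. cnj (fst v))"
  define f4' where "f4' = (\<lambda>v. cnj (f 4 v))"
  have f0: "f 0 = fst" by (simp add: f_def phi_simps fun_eq_iff)
  \<comment> \<open>dx is the real part of \<phi>^0, and its \<phi>^0 half meets a second factor
    \<phi>^0.\<close>
  have half: "wedge ((\<lambda>v. of_real (Re (fst v))) # f 0 # L) vs = 1/2 * wedge (f' # f 0 # L) vs" for L vs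
  proof -
    have "(\<lambda>v::CxC4. complex_of_real (Re (fst v))) = (\<lambda>v. 1/2 * f 0 v + 1/2 * f' v)"
      by (simp add: f0 f'_def fun_eq_iff complex_eq_iff)
    then show ?thesis
      using wedge_slot_linear[of "[]" "1/2" "f 0" "1/2" f' "f 0 # L" vs] wedge_repeat[of "f 0" "f 0 # L"]
      by simp
  qed
  have d0: "dphi 0 g = (\<lambda>_. 0)" by (simp add: dphi_def fun_eq_iff)
  have d4: "dphi 4 g = (\<lambda>v. (\<i> * of_real (\<alpha> * l2)) * f 4 v + (- of_real l2 * (1 - \<i> * of_real \<alpha>)) * f4' v)"
    by (simp add: dphi_def fun_eq_iff f_def f4'_def)
  have f10: "f j \<in> covectors_10 (\<J> g)" if "j < 5" for j unfolding f_def by (rule form_10[OF that])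
  have f'01: "f' \<in> covectors_01 (\<J> g)" using cnj_covectors_10[OF f10[of 0]] by (simp add: f'_def f0)
  have f4'01: "f4' \<in> covectors_01 (\<J> g)" unfolding f4'_def using cnj_covectors_10[OF f10[of 4]] by simp
  \<comment> \<open>The terms with two conjugate factors: cnj \<phi>^0 from dx, and one from the
    differentiated form.\<close>
  define \<omega> where "\<omega> vs = 1/2 * (wedge [f', f 0, dphi 1 g, f 2, f 3, f 4] vs
      + (wedge [f', f 0, f 1, dphi 2 g, f 3, f 4] vs
      + (wedge [f', f 0, f 1, f 2, dphi 3 g, f 4] vs
      + (- of_real l2 * (1 - \<i> * of_real \<alpha>)) * wedge [f', f 0, f 1, f 2, f 3, f4'] vs)))" for vs
  have "\<omega> \<in> Lambda (\<J> g) 4 2"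
  proof -
    have "wedge [f', f 0, dphi 1 g, f 2, f 3, f 4] \<in> Lambda (\<J> g) 4 2"
      by (rule Lambda_mset[of _ "[f 0, f 2, f 3, f 4]" "[f', dphi 1 g]"]) (use f10 f'01 dphi_01[of 1] in auto)
    moreover have "wedge [f', f 0, f 1, dphi 2 g, f 3, f 4] \<in> Lambda (\<J> g) 4 2"
      by (rule Lambda_mset[of _ "[f 0, f 1, f 3, f 4]" "[f', dphi 2 g]"]) (use f10 f'01 dphi_01[of 2] in auto)
    moreover have "wedge [f', f 0, f 1, f 2, dphi 3 g, f 4] \<in> Lambda (\<J> g) 4 2"
      by (rule Lambda_mset[of _ "[f 0, f 1, f 2, f 4]" "[f', dphi 3 g]"]) (use f10 f'01 dphi_01[of 3] in auto)
    moreover have "wedge [f', f 0, f 1, f 2, f 3, f4'] \<in> Lambda (\<J> g) 4 2"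
      by (rule Lambda_mset[of _ "[f 0, f 1, f 2, f 3]" "[f', f4']"]) (use f10 f'01 f4'01 in auto)
    ultimately show ?thesis
      unfolding Lambda_def \<omega>_def[abs_def] by (intro cspan_scale cspan_add)
  qed
  moreover have "(\<Sum>k<5. wedge ((\<lambda>v. of_real (Re (fst v))) # (map f [0..<5])[k := dphi k g]) vs)
       = \<i> * of_real (\<alpha> * l2) / 2 * wedge (f' # map f [0..<5]) vs + \<omega> vs" for vs
  proof -
    let ?E = "\<lambda>v::CxC4. complex_of_real (Re (fst v))"
    have "wedge [?E, dphi 0 g, f 1, f 2, f 3, f 4] vs = 0"
      by (subst wedge_swap) (simp add: d0 wedge_head_zero)
    moreover have "wedge [?E, f 0, f 1, f 2, f 3, dphi 4 g] vs
        = (\<i> * of_real (\<alpha> * l2)) * wedge [?E, f 0, f 1, f 2, f 3, f 4] vs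
          + (- of_real l2 * (1 - \<i> * of_real \<alpha>)) * wedge [?E, f 0, f 1, f 2, f 3, f4'] vs"
      using wedge_slot_linear[of "[?E, f 0, f 1, f 2, f 3]" _ "f 4" _ f4' "[]" vs]
      unfolding d4 append.simps .
    ultimately have "wedge [?E, dphi 0 g, f 1, f 2, f 3, f 4] vs
        + wedge [?E, f 0, dphi 1 g, f 2, f 3, f 4] vs + wedge [?E, f 0, f 1, dphi 2 g, f 3, f 4] vs
        + wedge [?E, f 0, f 1, f 2, dphi 3 g, f 4] vs + wedge [?E, f 0, f 1, f 2, f 3, dphi 4 g] vs
        = \<i> * of_real (\<alpha> * l2) / 2 * wedge [f', f 0, f 1, f 2, f 3, f 4] vs + \<omega> vs"
      unfolding half \<omega>_def by (simp only:) (simp add: algebra_simps)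
    then show ?thesis by (simp add: upt_5 eval_nat_numeral)
  qed
  ultimately show ?thesis unfolding f_def f'_def by blast
qed

text \<open>The Dolbeault derivative of G plus G times the connection form found in
  \<open>dOmega\<close>. The (1,0)-part of G' drops out, being a combination of factors already
  present in \<Omega>.\<close>

lemma dbar_scaled:
  assumes "open V" "g \<in> V" and s: "\<And>y. y \<in> V \<Longrightarrow> s y = (\<lambda>us. G y * \<Omega> y us)"
    and G: "(G has_derivative G') (at g)"
  shows "dbar 5 \<J> s g = (\<lambda>(v, us).
    ((G' v + \<i> * G' (\<J> g v)) / 2 + G g * (\<i> * of_real (\<alpha> * l2) / 2) * cnj (fst v)) * \<Omega> g us)"
proof -
  let ?E = "\<lambda>v::CxC4. complex_of_real (Re (fst v))"
  let ?\<Phi> = "map (\<lambda>j. \<phi> j g) [0..<5]"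
  define G01 where "G01 v = (G' v + \<i> * G' (\<J> g v)) / 2" for v
  define G10 where "G10 v = (G' v - \<i> * G' (\<J> g v)) / 2" for v
  define b where "b v = G01 v + G g * (\<i> * of_real (\<alpha> * l2) / 2) * cnj (fst v)" for v
  have G': "linear G'" using G has_derivative_linear by blast
  have split: "G' = (\<lambda>v. G10 v + G01 v)" by (simp add: fun_eq_iff G10_def G01_def field_simps)
  have "(\<lambda>v. cnj (fst v)) \<in> covectors_01 (\<J> g)"
    using cnj_covectors_10[OF form_10[of 0]] by (simp add: phi_simps)
  then have b: "b \<in> covectors_01 (\<J> g)"
    unfolding b_def[abs_def] G01_def by (intro covectors_01_add covectors_01_scale linear_part_01 G')
  obtain \<omega> where \<omega>: "\<omega> \<in> Lambda (\<J> g) 4 2"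
    and sum: "\<And>vs. (\<Sum>k<5. wedge (?E # ?\<Phi>[k := dphi k g]) vs)
       = \<i> * of_real (\<alpha> * l2) / 2 * wedge ((\<lambda>v. cnj (fst v)) # ?\<Phi>) vs + \<omega> vs"
    using dOmega by blast
  have "((\<lambda>y. s y us) has_derivative (\<lambda>v. G g * (?E v * (\<Sum>k<5. wedge (?\<Phi>[k := dphi k g]) us)) + G' v * \<Omega> g us)) (at g)" for us
  proof (rule has_derivative_transform_within_open)
    show "((\<lambda>y. G y * \<Omega> y us) has_derivative
        (\<lambda>v. G g * (?E v * (\<Sum>k<5. wedge (?\<Phi>[k := dphi k g]) us)) + G' v * \<Omega> g us)) (at g)"
      by (rule has_derivative_mult[OF G Omega_has_derivative])
  qed (use assms in auto)
  then have fd: "frechet_derivative (\<lambda>y. s y us) (at g)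
      = (\<lambda>v. G g * (?E v * (\<Sum>k<5. wedge (?\<Phi>[k := dphi k g]) us)) + G' v * \<Omega> g us)" for us
    using frechet_derivative_at by (metis (no_types, lifting))
  have "ext_deriv s g vs = wedge (b # ?\<Phi>) vs + G g * \<omega> vs" for vs
  proof -
    have "(\<lambda>(v, us). frechet_derivative (\<lambda>y. s y us) (at g) v)
        = (\<lambda>p. G g * (\<Sum>k<5. case p of (v, us) \<Rightarrow> ?E v * wedge (?\<Phi>[k := dphi k g]) us)
            + 1 * (case p of (v, us) \<Rightarrow> G' v * wedge ?\<Phi> us))"
      by (auto simp: fd \<Omega>_def sum_distrib_left)
    then have "ext_deriv s g vs = G g * (\<Sum>k<5. wedge (?E # ?\<Phi>[k := dphi k g]) vs) + wedge (G' # ?\<Phi>) vs"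
      unfolding ext_deriv_def by (simp only: alt_linear alt_sum wedge_Cons) simp
    also have "wedge (G' # ?\<Phi>) vs = wedge ((\<lambda>v. G10 v + G01 v) # ?\<Phi>) vs"
      by (subst split) (rule refl)
    also have "\<dots> = wedge (G10 # ?\<Phi>) vs + wedge (G01 # ?\<Phi>) vs" by (rule wedge_head_add)
    also have "wedge (G10 # ?\<Phi>) vs = 0"
      unfolding G10_def[abs_def] by (rule wedge_10_top[OF linear_part_10[OF G']])
    finally have "ext_deriv s g vs = G g * (\<Sum>k<5. wedge (?E # ?\<Phi>[k := dphi k g]) vs)
        + wedge (G01 # ?\<Phi>) vs" by simp
    moreover have "wedge (b # ?\<Phi>) vs = wedge (G01 # ?\<Phi>) vs
        + G g * (\<i> * of_real (\<alpha> * l2) / 2) * wedge ((\<lambda>v. cnj (fst v)) # ?\<Phi>) vs"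
      unfolding b_def[abs_def] by (simp only: wedge_head_add wedge_head_scale)
    ultimately show ?thesis unfolding sum
      by (simp add: algebra_simps)
  qed
  moreover have "(\<lambda>vs. G g * \<omega> vs) \<in> Lambda (\<J> g) (5 - 1) 2"
    using \<omega> by (simp add: Lambda_def cspan_scale)
  ultimately have "dbar 5 \<J> s g = (\<lambda>(v, us). b v * top_form g us)"
    using b by (intro dbar_eqI[where Jf = \<J> and g = g]) auto
  then show ?thesis by (simp add: b_def G01_def top_form_eq)
qed

end

section \<open>The lattice and the charts of the quotient\<close>

abbreviation of_int_vec :: "int^'n \<Rightarrow> real^'n" where
  "of_int_vec a \<equiv> \<chi> i. of_int (a $ i)"

lemma det_map_matrix_of_int: "det (map_matrix real_of_int A) = of_int (det A)"
  by (simp add: det_def map_matrix_def)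

lemma map_matrix_of_int_vec: "map_matrix real_of_int A *v of_int_vec a = of_int_vec (A *v a)"
  by (simp add: vec_eq_iff matrix_vector_mult_def map_matrix_def)

text \<open>By Cramer's rule the solution has integer determinants as numerators and det A = 1 as
  denominator. This makes M invertible on the integer lattice, as negative shifts of x
  require.\<close>

lemma unimodular_surj:
  fixes A :: "int^'n^'n"
  assumes "det A = 1"
  shows "\<exists>b. map_matrix real_of_int A *v of_int_vec b = of_int_vec a"
proof -
  let ?A = "map_matrix real_of_int A"
  have det: "det ?A = 1" using assms by (simp add: det_map_matrix_of_int)
  have "det (\<chi> i j. if j = k then of_int_vec a $ i else ?A $ i $ j)
      = of_int (det (\<chi> i j. if j = k then a $ i else A $ i $ j))" for k
    unfolding det_map_matrix_of_int[symmetric]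
    by (rule arg_cong[where f = det]) (simp add: vec_eq_iff map_matrix_def)
  then have "?A *v of_int_vec (\<chi> k. det (\<chi> i j. if j = k then a $ i else A $ i $ j)) = of_int_vec a"
    by (subst cramer) (simp_all add: det)
  then show ?thesis by blast
qed

definition complex_vec :: "real^'n \<Rightarrow> real^'n \<Rightarrow> complex^'n" where
  "complex_vec u w = (\<chi> j. Complex (u $ j) (w $ j))"

text \<open>This comparison carries discreteness from the real lattice to the complex one; the next
  lemma does the same for coboundedness.\<close>

lemma norm_complex_vec_ge:
  "norm u \<le> norm (complex_vec u w)" "norm w \<le> norm (complex_vec u w)"
  unfolding norm_vec_def complex_vec_def
  by (rule L2_set_mono; simp add: abs_Re_le_cmod[of "Complex _ _", simplified] abs_Im_le_cmod[of "Complex _ _", simplified])+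

lemma norm_complex_vec_le:
  fixes u w :: "real^'n"
  shows "norm (complex_vec u w) \<le> CARD('n) * (norm u + norm w)"
proof -
  have "norm (complex_vec u w) \<le> (\<Sum>j\<in>UNIV. norm (complex_vec u w $ j))"
    unfolding norm_vec_def by (rule L2_set_le_sum) simp
  also have "\<dots> \<le> (\<Sum>j\<in>(UNIV::'n set). norm u + norm w)"
  proof (rule sum_mono)
    fix j
    have "norm (complex_vec u w $ j) \<le> \<bar>u $ j\<bar> + \<bar>w $ j\<bar>"
      using cmod_le[of "complex_vec u w $ j"] by (simp add: complex_vec_def)
    then show "norm (complex_vec u w $ j) \<le> norm u + norm w"
      using component_le_norm_cart[of u j] component_le_norm_cart[of w j] by linarith
  qed
  finally show ?thesis by simp
qed

locale nakamura = nakamura_forms l1 l2 t for l1 l2 :: real and t :: "real^2" +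
  fixes M :: "int^4^4" and P :: "real^4^4" and \<tau> :: real
  assumes det_M: "det M = 1" and inv_P: "invertible P"
    and conj_M: "P ** map_matrix real_of_int M ** matrix_inv P = exp_diag l1 l2"
    and l2_nonzero: "l2 \<noteq> 0" and tau_nonzero: "\<tau> \<noteq> 0"
begin

abbreviation \<Gamma> :: "CxC4 set" where "\<Gamma> \<equiv> Gamma P \<tau>"
abbreviation act :: "CxC4 \<Rightarrow> CxC4 \<Rightarrow> CxC4" where "act \<equiv> sdprod l1 l2"
abbreviation proj :: "CxC4 \<Rightarrow> CxC4 set" where "proj \<equiv> coset P \<tau> l1 l2"
abbreviation atlas :: "(CxC4, CxC4 set) param set" where "atlas \<equiv> N5 P \<tau> l1 l2"

section \<open>The real lattice and its dilations\<close>

definition L :: "(real^4) set" where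
  "L = range (\<lambda>a. P *v of_int_vec a)"

definition dil :: "real \<Rightarrow> real^4 \<Rightarrow> real^4" where
  "dil m u = (\<chi> j. exp (weight l1 l2 $ j * m) * u $ j)"

lemma P_inv: "P *v (matrix_inv P *v u) = u" "matrix_inv P *v (P *v u) = u"
proof -
  have "P ** matrix_inv P = mat 1 \<and> matrix_inv P ** P = mat 1"
    using inv_P unfolding invertible_def matrix_inv_def by (rule someI_ex)
  then show "P *v (matrix_inv P *v u) = u" "matrix_inv P *v (P *v u) = u"
    by (simp_all add: matrix_vector_mul_assoc)
qed

lemma dil_add: "dil (m + n) u = dil m (dil n u)"
  by (simp add: dil_def distrib_left exp_add mult.assoc)

lemma dil_0: "dil 0 u = u"
  by (simp add: dil_def)

text \<open>P intertwines M with the dilation belonging to a unit step in x, so integrality of M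
  makes the lattice stable under it.\<close>

lemma dil_1_P: "dil 1 (P *v x) = P *v (map_matrix real_of_int M *v x)"
proof -
  have "dil 1 u = exp_diag l1 l2 *v u" for u
    by (simp add: dil_def exp_diag_def matrix_vector_mult_def vec_eq_iff if_distrib[of "\<lambda>x. x * _"] cong: if_cong)
  then show ?thesis
    by (simp add: P_inv conj_M[symmetric] matrix_vector_mul_assoc[symmetric])
qed

lemma L_add: "u \<in> L \<Longrightarrow> w \<in> L \<Longrightarrow> u + w \<in> L"
proof -
  assume "u \<in> L" "w \<in> L"
  then obtain a b where "u = P *v of_int_vec a" "w = P *v of_int_vec b" by (auto simp: L_def)
  then have "u + w = P *v of_int_vec (a + b)"
    using matrix_vector_right_distrib[of P "of_int_vec a" "of_int_vec b"]
    by (simp add: plus_vec_def)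
  then show ?thesis unfolding L_def by (rule range_eqI)
qed

lemma L_uminus: "u \<in> L \<Longrightarrow> - u \<in> L"
proof -
  assume "u \<in> L"
  then obtain a where u: "u = P *v of_int_vec a" by (auto simp: L_def)
  have "of_int_vec (- a) = (- 1) *\<^sub>R of_int_vec a" by (simp add: vec_eq_iff)
  then have "- u = P *v of_int_vec (- a)"
    using matrix_vector_mult_scaleR[of P "- 1" "of_int_vec a"] unfolding u by simp
  then show ?thesis unfolding L_def by (rule range_eqI)
qed

lemma L_0: "0 \<in> L"
proof -
  have "P *v of_int_vec 0 = 0" by (simp add: matrix_vector_mult_def vec_eq_iff)
  then show ?thesis unfolding L_def by (metis rangeI)
qed

lemma L_dil: "u \<in> L \<Longrightarrow> dil (of_int m) u \<in> L"
proof -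
  assume u: "u \<in> L"
  have up: "dil 1 u \<in> L" if "u \<in> L" for u
    using that by (auto simp: L_def dil_1_P map_matrix_of_int_vec)
  have down: "dil (- 1) u \<in> L" if u: "u \<in> L" for u
  proof -
    obtain a where a: "u = P *v of_int_vec a" using u by (auto simp: L_def)
    obtain b where "map_matrix real_of_int M *v of_int_vec b = of_int_vec a"
      using unimodular_surj[OF det_M] by blast
    then have "u = dil 1 (P *v of_int_vec b)" by (simp add: a dil_1_P)
    then have "dil (- 1) u = P *v of_int_vec b" by (simp add: dil_0 flip: dil_add)
    then show ?thesis by (simp add: L_def)
  qed
  show ?thesis
  proof (induction m rule: int_induct[where k = 0])
    case base
    show ?case using u by (simp add: dil_0)
  next
    case (step1 i)
    then show ?case using up[of "dil (of_int i) u"] by (simp add: add.commute flip: dil_add)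
  next
    case (step2 i)
    then show ?case using down[of "dil (of_int i) u"] by (simp flip: dil_add)
  qed
qed

text \<open>If B bounds the inverse of P, a lattice vector shorter than 1/B comes from an integer
  vector of norm below 1, all of whose entries are 0.\<close>

lemma L_discrete: "\<exists>\<delta>>0. \<forall>u\<in>L. norm u < \<delta> \<longrightarrow> u = 0"
proof -
  obtain B where B: "B > 0" "\<And>u. norm (matrix_inv P *v u) \<le> norm u * B"
    using bounded_linear.pos_bounded[OF matrix_vector_mul_bounded_linear[of "matrix_inv P"]] by blast
  have "u = 0" if u: "u \<in> L" "norm u < 1 / B" for u
  proof -
    obtain a where a: "u = P *v of_int_vec a" using u(1) by (auto simp: L_def)
    have "norm (of_int_vec a) \<le> norm u * B" using B(2)[of u] by (simp add: a P_inv)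
    also have "\<dots> < 1" using u(2) B(1) by (simp add: field_simps)
    finally have "\<bar>of_int_vec a $ i\<bar> < 1" for i using component_le_norm_cart[of "of_int_vec a" i] by linarith
    then have "\<bar>real_of_int (a $ i)\<bar> < 1" for i by simp
    then have "a $ i = 0" for i
      by (metis of_int_abs of_int_less_1_iff zabs_less_one_iff)
    then show ?thesis by (simp add: a matrix_vector_mult_def vec_eq_iff)
  qed
  then show ?thesis using B(1) by (intro exI[of _ "1 / B"]) auto
qed

text \<open>Rounding down the coordinates with respect to P leaves a vector in the unit cube. Its l1
  norm is at most 4, hence the radius 4 * B.\<close>

lemma L_cobounded: "\<exists>R. \<forall>u. \<exists>w\<in>L. norm (u + w) \<le> R"
proof -
  obtain B where B: "B > 0" "\<And>u. norm (P *v u) \<le> norm u * B"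
    using bounded_linear.pos_bounded[OF matrix_vector_mul_bounded_linear[of P]] by blast
  have "\<exists>w\<in>L. norm (u + w) \<le> 4 * B" for u
  proof -
    define a where "a = (\<chi> i. - \<lfloor>(matrix_inv P *v u) $ i\<rfloor>)"
    let ?x = "matrix_inv P *v u + of_int_vec a"
    have "norm ?x \<le> (\<Sum>i\<in>UNIV. \<bar>?x $ i\<bar>)" by (rule norm_le_l1_cart)
    also have "\<dots> \<le> (\<Sum>i\<in>(UNIV::4 set). 1)"
    proof (rule sum_mono)
      fix i :: 4
      have "?x $ i = (matrix_inv P *v u) $ i - of_int \<lfloor>(matrix_inv P *v u) $ i\<rfloor>" by (simp add: a_def)
      then show "\<bar>?x $ i\<bar> \<le> 1"
        using of_int_floor_le[of "(matrix_inv P *v u) $ i"] real_of_int_floor_add_one_ge[of "(matrix_inv P *v u) $ i"]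
        by linarith
    qed
    finally have "norm ?x \<le> 4" by simp
    then have "norm (P *v ?x) \<le> 4 * B"
      using B(2)[of ?x] mult_right_mono[of "norm ?x" 4 B] B(1) by linarith
    then have "norm (u + P *v of_int_vec a) \<le> 4 * B"
      by (simp add: matrix_vector_right_distrib P_inv)
    then show ?thesis by (auto simp: L_def)
  qed
  then show ?thesis by blast
qed

section \<open>The group law on the lattice and its cosets\<close>

lemma Gamma_iff:
  "\<gamma> \<in> \<Gamma> \<longleftrightarrow> (\<exists>m n u w. u \<in> L \<and> w \<in> L \<and>
     \<gamma> = (Complex (of_int m) (\<tau> * of_int n), complex_vec u w))"
  unfolding Gamma_def L_def complex_vec_def by blast

lemma GammaI:
  "u \<in> L \<Longrightarrow> w \<in> L \<Longrightarrow> (Complex (of_int m) (\<tau> * of_int n), complex_vec u w) \<in> \<Gamma>"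
  unfolding Gamma_iff by blast

lemma rho_complex_vec: "rho l1 l2 z (complex_vec u w) = complex_vec (dil (Re z) u) (dil (Re z) w)"
  by (simp add: rho_def complex_vec_def dil_def vec_eq_iff complex_eq_iff)

lemma rho_add: "rho l1 l2 z (v + w) = rho l1 l2 z v + rho l1 l2 z w"
  by (simp add: rho_def vec_eq_iff algebra_simps)

lemma rho_rho: "rho l1 l2 z (rho l1 l2 z' v) = rho l1 l2 (z + z') v"
  by (simp add: rho_def vec_eq_iff distrib_left exp_add)

lemma rho_Re_0: "Re z = 0 \<Longrightarrow> rho l1 l2 z v = v"
  by (simp add: rho_def)

lemma act_assoc: "act (act a b) c = act a (act b c)"
  by (simp add: sdprod_def rho_add rho_rho add.assoc)

lemma act_0: "act 0 g = g"
  by (simp add: sdprod_def rho_Re_0)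

lemma Gamma_0: "0 \<in> \<Gamma>"
  using GammaI[OF L_0 L_0, of 0 0] by (simp add: complex_vec_def zero_vec_def zero_prod_def Complex_eq)

lemma Gamma_act:
  assumes "\<gamma> \<in> \<Gamma>" "\<gamma>' \<in> \<Gamma>"
  shows "act \<gamma> \<gamma>' \<in> \<Gamma>"
proof -
  from assms obtain m n u w m' n' u' w' where uw: "u \<in> L" "w \<in> L" "u' \<in> L" "w' \<in> L"
    and \<gamma>: "\<gamma> = (Complex (of_int m) (\<tau> * of_int n), complex_vec u w)"
      "\<gamma>' = (Complex (of_int m') (\<tau> * of_int n'), complex_vec u' w')"
    unfolding Gamma_iff by blast
  have "act \<gamma> \<gamma>' = (Complex (of_int (m + m')) (\<tau> * of_int (n + n')),
      complex_vec (dil (of_int m) u' + u) (dil (of_int m) w' + w))"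
    by (simp add: \<gamma> sdprod_def rho_complex_vec complex_eq_iff distrib_left)
      (simp add: complex_vec_def vec_eq_iff complex_eq_iff)
  then show ?thesis using uw by (simp only: GammaI L_add L_dil)
qed

lemma Gamma_inverse:
  assumes "\<gamma> \<in> \<Gamma>"
  shows "\<exists>\<gamma>'\<in>\<Gamma>. act \<gamma>' \<gamma> = 0"
proof -
  from assms obtain m n u w where uw: "u \<in> L" "w \<in> L"
    and \<gamma>: "\<gamma> = (Complex (of_int m) (\<tau> * of_int n), complex_vec u w)"
    unfolding Gamma_iff by blast
  let ?\<gamma>' = "(Complex (of_int (- m)) (\<tau> * of_int (- n)),
      complex_vec (- dil (of_int (- m)) u) (- dil (of_int (- m)) w))"
  have "act ?\<gamma>' \<gamma> = 0"
    by (simp add: \<gamma> sdprod_def rho_complex_vec prod_eq_iff complex_eq_iff)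
      (simp add: complex_vec_def vec_eq_iff complex_eq_iff)
  moreover have "?\<gamma>' \<in> \<Gamma>" by (intro GammaI L_uminus L_dil uw)
  ultimately show ?thesis by blast
qed

lemma proj_self: "g \<in> proj g"
  unfolding coset_def using Gamma_0 act_0[of g] by (metis image_eqI)

lemma proj_eqD: "proj g = proj g' \<Longrightarrow> \<exists>\<gamma>\<in>\<Gamma>. g' = act \<gamma> g"
  using proj_self[of g'] unfolding coset_def by auto

lemma proj_act:
  assumes "\<gamma> \<in> \<Gamma>"
  shows "proj (act \<gamma> g) = proj g"
proof -
  have sub: "proj (act \<gamma> g) \<subseteq> proj g" if "\<gamma> \<in> \<Gamma>" for \<gamma> g
  proof
    fix x assume "x \<in> proj (act \<gamma> g)"
    then obtain \<gamma>' where "\<gamma>' \<in> \<Gamma>" "x = act (act \<gamma>' \<gamma>) g"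
      unfolding coset_def by (auto simp: act_assoc)
    then show "x \<in> proj g" unfolding coset_def using Gamma_act[OF _ that] by blast
  qed
  obtain \<gamma>' where "\<gamma>' \<in> \<Gamma>" "act \<gamma>' \<gamma> = 0" using Gamma_inverse[OF assms] by blast
  then have "proj g \<subseteq> proj (act \<gamma> g)"
    using sub[of \<gamma>' "act \<gamma> g"] by (simp add: act_assoc[symmetric] act_0)
  then show ?thesis using sub[OF assms] by blast
qed

text \<open>The base shift has to be excluded first: only when Re z is not shifted does the lattice
  element act on the fibre as a translation by \<open>complex_vec u w\<close>, to which the
  discreteness bound \<delta> applies.\<close>

lemma injective_balls: "\<exists>\<delta>>0. \<forall>g. inj_on proj (ball g \<delta>)"
proof -
  obtain \<delta> where \<delta>: "\<delta> > 0" "\<And>u. u \<in> L \<Longrightarrow> norm u < \<delta> \<Longrightarrow> u = 0" using L_discrete by blast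
  \<comment> \<open>Halved, because two points of the ball are only known to be less than 2 *
    \<epsilon> apart.\<close>
  define \<epsilon> where "\<epsilon> = min (1/2) (min (\<bar>\<tau>\<bar> / 2) (\<delta> / 2))"
  have "inj_on proj (ball g \<epsilon>)" for g
  proof (rule inj_onI)
    fix x y assume xy: "x \<in> ball g \<epsilon>" "y \<in> ball g \<epsilon>" "proj x = proj y"
    have "dist y x < 2 * \<epsilon>" using xy dist_triangle2[of y x g] by (simp add: dist_commute)
    then have norm: "norm (y - x) < 1" "norm (y - x) < \<bar>\<tau>\<bar>" "norm (y - x) < \<delta>"
      by (auto simp: \<epsilon>_def dist_norm)
    obtain \<gamma> where "\<gamma> \<in> \<Gamma>" "y = act \<gamma> x" using proj_eqD[OF xy(3)] by blast
    then obtain m n u w where uw: "u \<in> L" "w \<in> L"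
      and y: "y = act (Complex (of_int m) (\<tau> * of_int n), complex_vec u w) x"
      unfolding Gamma_iff by blast
    let ?z = "Complex (of_int m) (\<tau> * of_int n)"
    have "norm (fst (y - x)) \<le> norm (y - x)" by (metis norm_fst_le prod.collapse)
    then have z: "norm ?z \<le> norm (y - x)" by (simp add: y sdprod_def)
    then have "\<bar>real_of_int m\<bar> < 1" using abs_Re_le_cmod[of ?z] norm by simp
    then have m: "m = 0" by simp
    have "\<bar>\<tau>\<bar> * \<bar>real_of_int n\<bar> < \<bar>\<tau>\<bar>" using abs_Im_le_cmod[of ?z] z norm by (simp add: abs_mult)
    then have n: "n = 0" using tau_nonzero by (simp add: mult_less_cancel_left1)
    have "norm (snd (y - x)) \<le> norm (y - x)" by (metis norm_snd_le prod.collapse)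
    moreover have "snd (y - x) = complex_vec u w" by (simp add: y m sdprod_def rho_Re_0)
    ultimately have "norm (complex_vec u w) < \<delta>" using norm(3) by simp
    then have "u = 0" "w = 0" using \<delta>(2) uw norm_complex_vec_ge[where u = u and w = w] by force+
    then show "x = y" by (simp add: y m n sdprod_def rho_Re_0 prod_eq_iff complex_eq_iff)
      (simp add: complex_vec_def vec_eq_iff complex_eq_iff)
  qed
  moreover have "\<epsilon> > 0" using \<delta>(1) tau_nonzero by (simp add: \<epsilon>_def)
  ultimately show ?thesis by blast
qed

lemma atlas_cover: "\<exists>c\<in>atlas. g \<in> fst c"
proof -
  obtain \<delta> where "\<delta> > 0" "inj_on proj (ball g \<delta>)" using injective_balls by blast
  then have "(ball g \<delta>, proj) \<in> atlas" "g \<in> fst (ball g \<delta>, proj)" by (auto simp: N5_def)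
  then show ?thesis by blast
qed

lemma Gamma_cobounded: "\<exists>R. \<forall>g. \<exists>\<gamma>\<in>\<Gamma>. act \<gamma> g \<in> cball 0 R"
proof -
  obtain R where R: "\<And>u. \<exists>w\<in>L. norm (u + w) \<le> R" using L_cobounded by blast
  have "\<exists>\<gamma>\<in>\<Gamma>. act \<gamma> g \<in> cball 0 ((1 + \<bar>\<tau>\<bar>) + 4 * (R + R))" for g
  proof -
    define m where "m = - \<lfloor>Re (fst g)\<rfloor>"
    define n where "n = - \<lfloor>Im (fst g) / \<tau>\<rfloor>"
    let ?z = "Complex (of_int m) (\<tau> * of_int n)"
    \<comment> \<open>The fibre coordinate after the base shift. The product dilates before it
      translates, so the lattice vectors must be chosen for this one.\<close>
    let ?v = "rho l1 l2 ?z (snd g)"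
    obtain u w where uw: "u \<in> L" "w \<in> L" and
      "norm ((\<chi> j. Re (?v $ j)) + u) \<le> R" "norm ((\<chi> j. Im (?v $ j)) + w) \<le> R" using R by metis
    then have "norm (complex_vec ((\<chi> j. Re (?v $ j)) + u) ((\<chi> j. Im (?v $ j)) + w)) \<le> 4 * (R + R)"
      by (intro order.trans[OF norm_complex_vec_le]) simp
    moreover have "complex_vec ((\<chi> j. Re (?v $ j)) + u) ((\<chi> j. Im (?v $ j)) + w) = ?v + complex_vec u w"
      by (simp add: complex_vec_def vec_eq_iff complex_eq_iff)
    ultimately have "norm (snd (act (?z, complex_vec u w) g)) \<le> 4 * (R + R)"
      by (simp add: sdprod_def)
    moreover have "norm (fst (act (?z, complex_vec u w) g)) \<le> 1 + \<bar>\<tau>\<bar>"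
    proof -
      have "\<bar>of_int m + Re (fst g)\<bar> \<le> 1"
        using of_int_floor_le[of "Re (fst g)"] real_of_int_floor_add_one_ge[of "Re (fst g)"]
        unfolding m_def of_int_minus by linarith
      moreover have "\<bar>\<tau> * of_int n + Im (fst g)\<bar> \<le> \<bar>\<tau>\<bar>"
      proof -
        have "\<bar>of_int n + Im (fst g) / \<tau>\<bar> \<le> 1"
          using of_int_floor_le[of "Im (fst g) / \<tau>"] real_of_int_floor_add_one_ge[of "Im (fst g) / \<tau>"]
          unfolding n_def of_int_minus by linarith
        then have "\<bar>\<tau>\<bar> * \<bar>of_int n + Im (fst g) / \<tau>\<bar> \<le> \<bar>\<tau>\<bar>" by (simp add: mult_left_le)
        then show ?thesis using tau_nonzero by (simp add: distrib_left flip: abs_mult)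
      qed
      ultimately show ?thesis using cmod_le[of "?z + fst g"] by (simp add: sdprod_def)
    qed
    ultimately have "norm (act (?z, complex_vec u w) g) \<le> (1 + \<bar>\<tau>\<bar>) + 4 * (R + R)"
      using norm_Pair_le[of "fst (act (?z, complex_vec u w) g)" "snd (act (?z, complex_vec u w) g)"] by simp
    then show ?thesis using GammaI[OF uw] by (metis dist_0_norm mem_cball)
  qed
  then show ?thesis by blast
qed

section \<open>Lattice translations as transition maps\<close>

definition dact :: "CxC4 \<Rightarrow> CxC4 \<Rightarrow> CxC4" where
  "dact \<gamma> w = (fst w, rho l1 l2 (fst \<gamma>) (snd w))"

lemma act_has_derivative: "(act \<gamma> has_derivative dact \<gamma>) (at g)"
proof -
  have "linear (dact \<gamma>)"
    by (rule linearI) (simp_all add: dact_def rho_def vec_eq_iff algebra_simps)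
  then have "(dact \<gamma> has_derivative dact \<gamma>) (at g)" by (simp add: linear_imp_has_derivative)
  then have "((\<lambda>x. dact \<gamma> x + \<gamma>) has_derivative dact \<gamma>) (at g)"
    by (rule has_derivative_add_const)
  moreover have "act \<gamma> = (\<lambda>x. dact \<gamma> x + \<gamma>)"
    by (simp add: fun_eq_iff sdprod_def dact_def prod_eq_iff)
  ultimately show ?thesis by simp
qed

text \<open>As the projection is injective on the target chart, \<open>act \<gamma> y\<close> is the
  only representative of its class there, and openness of the chart keeps it there for y near x. So
  the transition map is a translation near x.\<close>

lemma transition_act:
  assumes c: "c \<in> atlas" "c' \<in> atlas" and x: "x \<in> fst c" and \<gamma>: "\<gamma> \<in> \<Gamma>" and x': "act \<gamma> x \<in> fst c'"
  shows "snd c x \<in> snd c' ` fst c'"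
    and "transition c c' x = act \<gamma> x"
    and "frechet_derivative (transition c c') (at x) = dact \<gamma>"
proof -
  have snd: "snd c = proj" "snd c' = proj" and "open (fst c')" and inj: "inj_on proj (fst c')"
    using c by (auto simp: N5_def)
  have eq: "transition c c' y = act \<gamma> y" if "act \<gamma> y \<in> fst c'" for y
    using inv_into_f_f[OF inj that] by (simp add: transition_def snd proj_act[OF \<gamma>])
  show "snd c x \<in> snd c' ` fst c'" unfolding snd using x' proj_act[OF \<gamma>] by (metis image_eqI)
  show "transition c c' x = act \<gamma> x" by (rule eq[OF x'])
  have "continuous_on UNIV (act \<gamma>)"
    by (intro continuous_at_imp_continuous_on ballI has_derivative_continuous[OF act_has_derivative])
  then have "open (act \<gamma> -` fst c')" using \<open>open (fst c')\<close> by (simp add: continuous_on_open_vimage)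
  then have "(transition c c' has_derivative dact \<gamma>) (at x)"
    by (rule has_derivative_transform_within_open[OF act_has_derivative]) (use x' eq in auto)
  then show "frechet_derivative (transition c c') (at x) = dact \<gamma>"
    using frechet_derivative_at by metis
qed

lemma atlas_overlapD:
  assumes c: "c \<in> atlas" "c' \<in> atlas" and "snd c x \<in> snd c' ` fst c'"
  shows "\<exists>\<gamma>\<in>\<Gamma>. act \<gamma> x \<in> fst c'"
proof -
  have "snd c = proj" "snd c' = proj" using c by (auto simp: N5_def)
  then obtain y where "y \<in> fst c'" "proj x = proj y" using assms by auto
  then show ?thesis using proj_eqD by metis
qed

text \<open>The coframe is left invariant: the exponential factor that \<open>dact\<close> puts on a
  coordinate cancels the change of the exponential coefficient of the form.\<close>

lemma Omega_invariant: "\<Omega> (act \<gamma> g) (map (dact \<gamma>) us) = \<Omega> g us"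
proof -
  have exp: "exp (c * (a + x)) * (exp (- (c * a)) * k) = exp (c * x) * k" for a c x k :: real
    by (simp add: distrib_left exp_add exp_minus)
  have exp': "exp (- c * (a + x)) * (exp (c * a) * k) = exp (- c * x) * k" for a c x k :: real
    using exp[of "- c"] by simp
  have "\<phi> j (act \<gamma> g) (dact \<gamma> w) = \<phi> j g w" if "j < 5" for j w
  proof -
    have "fst (dact \<gamma> w) = fst w" "Re (fst (act \<gamma> g)) = Re (fst \<gamma>) + Re (fst g)"
      and "snd (dact \<gamma> w) $ i = of_real (exp (weight l1 l2 $ i * Re (fst \<gamma>))) * snd w $ i" for i
      by (simp_all add: dact_def sdprod_def rho_def)
    then show ?thesis
      using that unfolding less_5_cases
      by (elim disjE; simp only: phi_simps) (simp_all add: weight_def exp exp'[simplified])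
  qed
  then have "map (\<lambda>a v. a (dact \<gamma> v)) (map (\<lambda>j. \<phi> j (act \<gamma> g)) [0..<5]) = map (\<lambda>j. \<phi> j g) [0..<5]"
    by auto
  then show ?thesis unfolding \<Omega>_def wedge_map by (simp only:)
qed

end

section \<open>Smooth functions\<close>

lemma C_k_on_const: "C_k_on k U (\<lambda>_. c)"
proof (induction k arbitrary: c)
  case (Suc k)
  then show ?case by (auto intro!: exI[of _ "\<lambda>_ _. 0"])
qed simp

lemma C_k_on_Suc_imp: "C_k_on (Suc k) U f \<Longrightarrow> C_k_on k U f"
proof (induction k arbitrary: f)
  case 0
  then obtain f' where "\<forall>x\<in>U. (f has_derivative f' x) (at x)" by auto
  then have "\<forall>x\<in>U. isCont f x" using has_derivative_continuous by blast
  then show ?case by (simp add: continuous_at_imp_continuous_on)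
next
  case (Suc k)
  then obtain f' where "\<forall>x\<in>U. (f has_derivative f' x) (at x)" "\<forall>v. C_k_on (Suc k) U (\<lambda>x. f' x v)"
    by (subst (asm) C_k_on.simps(2)) blast
  then show ?case using Suc.IH by auto
qed

lemma C_k_on_cong:
  assumes "open U" "\<And>x. x \<in> U \<Longrightarrow> f x = g x" "C_k_on k U f"
  shows "C_k_on k U g"
proof (cases k)
  case 0
  then show ?thesis using assms(2,3) continuous_on_cong by force
next
  case (Suc n)
  with assms(3) obtain f' where f': "\<forall>x\<in>U. (f has_derivative f' x) (at x)" "\<forall>v. C_k_on n U (\<lambda>x. f' x v)"
    by auto
  have "(g has_derivative f' x) (at x)" if "x \<in> U" for x
    by (rule has_derivative_transform_within_open[OF _ assms(1) that assms(2)]) (use f'(1) that in auto)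
  then show ?thesis using f'(2) Suc by auto
qed

lemma C_k_on_add: "C_k_on k U f \<Longrightarrow> C_k_on k U g \<Longrightarrow> C_k_on k U (\<lambda>x. f x + g x)"
proof (induction k arbitrary: f g)
  case (Suc k)
  then obtain f' g' where d: "\<forall>x\<in>U. (f has_derivative f' x) (at x)" "\<forall>v. C_k_on k U (\<lambda>x. f' x v)"
    "\<forall>x\<in>U. (g has_derivative g' x) (at x)" "\<forall>v. C_k_on k U (\<lambda>x. g' x v)" by auto
  then have "\<forall>v. C_k_on k U (\<lambda>x. f' x v + g' x v)" using Suc.IH by simp
  moreover have "\<forall>x\<in>U. ((\<lambda>x. f x + g x) has_derivative (\<lambda>v. f' x v + g' x v)) (at x)"
    using d by (simp add: has_derivative_add)
  ultimately show ?case
    unfolding C_k_on.simps by (intro exI[of _ "\<lambda>x v. f' x v + g' x v"] conjI)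
qed (simp add: continuous_on_add)

lemma C_k_on_mult: "C_k_on k U f \<Longrightarrow> C_k_on k U g \<Longrightarrow> C_k_on k U (\<lambda>x. f x * g x)"
proof (induction k arbitrary: f g)
  case (Suc k)
  then obtain f' g' where d: "\<forall>x\<in>U. (f has_derivative f' x) (at x)" "\<forall>v. C_k_on k U (\<lambda>x. f' x v)"
    "\<forall>x\<in>U. (g has_derivative g' x) (at x)" "\<forall>v. C_k_on k U (\<lambda>x. g' x v)" by auto
  have "C_k_on k U f" "C_k_on k U g" using Suc.prems C_k_on_Suc_imp by blast+
  then have "\<forall>v. C_k_on k U (\<lambda>x. f x * g' x v + f' x v * g x)"
    using d Suc.IH by (simp add: C_k_on_add)
  moreover have "\<forall>x\<in>U. ((\<lambda>x. f x * g x) has_derivative (\<lambda>v. f x * g' x v + f' x v * g x)) (at x)"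
    using d by (auto intro: has_derivative_mult)
  ultimately show ?case
    unfolding C_k_on.simps by (intro exI[of _ "\<lambda>x v. f x * g' x v + f' x v * g x"] conjI)
qed (simp add: continuous_on_mult)

lemma exp_Re_has_derivative:
  fixes c :: complex
  shows "((\<lambda>g :: CxC4. exp (c * of_real (Re (fst g)))) has_derivative
    (\<lambda>v. c * of_real (Re (fst v)) * exp (c * of_real (Re (fst g))))) (at g)"
proof -
  have "((\<lambda>g :: CxC4. c * complex_of_real (Re (fst g))) has_derivative (\<lambda>v. c * of_real (Re (fst v)))) (at g)"
    by (auto intro!: derivative_eq_intros)
  from has_derivative_compose[OF this DERIV_exp[unfolded has_field_derivative_def]]
  show ?thesis by (simp add: mult.commute)
qed

lemma C_k_on_exp:
  "C_k_on k U (\<lambda>g :: CxC4. exp (c * of_real (Re (fst g))))"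
proof (induction k)
  case 0
  show ?case by (auto intro!: continuous_intros)
next
  case (Suc k)
  have "C_k_on k U (\<lambda>g :: CxC4. c * of_real (Re (fst v)) * exp (c * of_real (Re (fst g))))" for v :: CxC4
    by (intro C_k_on_mult C_k_on_const Suc)
  then show ?case
    unfolding C_k_on.simps using exp_Re_has_derivative
    by (intro exI[of _ "\<lambda>g v. c * of_real (Re (fst v)) * exp (c * of_real (Re (fst g)))"] conjI) blast+
qed

lemma smooth_on_const: "smooth_on U (\<lambda>_. c)"
  by (simp add: smooth_on_def C_k_on_const)

lemma smooth_on_cong: "open U \<Longrightarrow> (\<And>x. x \<in> U \<Longrightarrow> f x = g x) \<Longrightarrow> smooth_on U f \<Longrightarrow> smooth_on U g"
  unfolding smooth_on_def using C_k_on_cong by blast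

lemma smooth_on_add: "smooth_on U f \<Longrightarrow> smooth_on U g \<Longrightarrow> smooth_on U (\<lambda>x. f x + g x)"
  by (simp add: smooth_on_def C_k_on_add)

lemma smooth_on_mult: "smooth_on U f \<Longrightarrow> smooth_on U g \<Longrightarrow> smooth_on U (\<lambda>x. f x * g x)"
  by (simp add: smooth_on_def C_k_on_mult)

lemma smooth_on_exp: "smooth_on U (\<lambda>g :: CxC4. exp (c * of_real (Re (fst g))))"
  by (simp add: smooth_on_def C_k_on_exp)

lemma smooth_on_sum: "(\<And>i. i \<in> I \<Longrightarrow> smooth_on U (f i)) \<Longrightarrow> smooth_on U (\<lambda>x. \<Sum>i\<in>I. f i x)"
  by (induction I rule: infinite_finite_induct) (simp_all add: smooth_on_const smooth_on_add)

lemma smooth_on_prod: "(\<And>i. i \<in> I \<Longrightarrow> smooth_on U (f i)) \<Longrightarrow> smooth_on U (\<lambda>x. \<Prod>i\<in>I. f i x)"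
  by (induction I rule: infinite_finite_induct) (simp_all add: smooth_on_const smooth_on_mult)

lemma smooth_on_imp_derivative:
  assumes "smooth_on U f" "x \<in> U"
  shows "\<exists>f'. (f has_derivative f') (at x)"
proof -
  have "C_k_on (Suc 0) U f" using assms(1) unfolding smooth_on_def by blast
  then show ?thesis using assms(2) by auto
qed

lemma smooth_on_wedge:
  assumes "\<And>j w. j \<in> set js \<Longrightarrow> smooth_on U (\<lambda>y. f j y w)"
  shows "smooth_on U (\<lambda>y. wedge (map (\<lambda>j. f j y) js) us)"
  using assms
proof (induction js arbitrary: us)
  case (Cons j js)
  then show ?case unfolding list.map wedge_Cons alt_def prod.case
    by (intro smooth_on_sum smooth_on_mult smooth_on_const) auto
qed (simp add: smooth_on_const)

section \<open>Pluricanonical sections\<close>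

lemma tensor_replicate:
  "tensor (replicate r \<omega>) uss = (if length uss = r then \<Prod>i<r. \<omega> (uss ! i) else 0)"
  by (simp add: tensor_def)

context nakamura
begin

lemma phi_smooth:
  assumes "j < 5"
  shows "smooth_on U (\<lambda>y. \<phi> j y w)"
proof -
  have Cexp: "smooth_on U (\<lambda>y. Complex (exp (c * Re (fst y)) * p) (exp (c' * Re (fst y)) * q))"
    for c c' p q :: real and U :: "CxC4 set"
  proof -
    have *: "(\<lambda>y::CxC4. Complex (exp (c * Re (fst y)) * p) (exp (c' * Re (fst y)) * q))
        = (\<lambda>y. exp (of_real c * of_real (Re (fst y))) * of_real p + exp (of_real c' * of_real (Re (fst y))) * (\<i> * of_real q))"
      by (simp add: fun_eq_iff Complex_eq exp_of_real mult_ac flip: of_real_mult)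
    show ?thesis unfolding * by (intro smooth_on_add smooth_on_mult smooth_on_exp smooth_on_const)
  qed
  consider "j = 0" | "j = 1" | "j = 2" | "j = 3" | "j = 4" using assms by linarith
  then show ?thesis
  proof cases
    case 5
    \<comment> \<open>\<open>Cexp\<close> admits one exponential in each part, so the imaginary part
      of \<phi>^4 is split in two; the real part of the second summand is a zero written in the
      required shape.\<close>
    have "(\<lambda>y::CxC4. Complex (exp (- l2 * Re (fst y)) * Im (snd w $ 3))
        (- (\<alpha> * (exp (- l2 * Re (fst y)) * Im (snd w $ 3)) + \<beta> * (exp (l2 * Re (fst y)) * Im (snd w $ 4)))))
      = (\<lambda>y. Complex (exp (- l2 * Re (fst y)) * Im (snd w $ 3)) (exp (- l2 * Re (fst y)) * (- \<alpha> * Im (snd w $ 3)))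
          + Complex (exp (0 * Re (fst y)) * 0) (exp (l2 * Re (fst y)) * (- \<beta> * Im (snd w $ 4))))"
      by (simp add: fun_eq_iff complex_eq_iff algebra_simps)
    then show ?thesis unfolding 5 phi_simps
      by (simp only:) (intro smooth_on_add Cexp)
  qed (simp_all only: phi_simps smooth_on_const Cexp)
qed

lemma Omega_smooth: "smooth_on U (\<lambda>y. \<Omega> y us)"
  unfolding \<Omega>_def by (rule smooth_on_wedge) (simp add: phi_smooth)

text \<open>Constant test vectors in the directions seen by E^0, ..., E^4. At every point the forms
  have a diagonal matrix with nonzero diagonal on them, so evaluation on \<open>us0\<close> reads
  off the coefficient of \<Omega>.\<close>

definition us0 :: "CxC4 list" where
  "us0 = [(1, 0), (0, axis 1 1), (0, axis 1 \<i>), (0, axis 3 1), (0, axis 3 \<i>)]"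

lemma Omega_us0: "\<Omega> g us0 \<noteq> 0"
proof -
  let ?L = "map (\<lambda>j. \<phi> j g) [0..<5]"
  have us0: "us0 ! 0 = (1, 0)" "us0 ! 1 = (0, axis 1 1)" "us0 ! 2 = (0, axis 1 \<i>)"
    "us0 ! 3 = (0, axis 3 1)" "us0 ! 4 = (0, axis 3 \<i>)"
    by (simp_all add: us0_def numeral_eq_Suc)
  have z: "\<phi> i g (us0 ! k) = 0 \<longleftrightarrow> i \<noteq> k" if "i < 5" "k < 5" for i k
    using that unfolding less_5_cases
    by (elim disjE; simp only: phi_simps us0) (simp_all add: axis_def complex_eq_iff)
  have "\<Omega> g us0 = (\<Prod>i<length ?L. (?L ! i) (us0 ! i))"
    unfolding \<Omega>_def by (rule wedge_diagonal) (use z in \<open>auto simp: us0_def\<close>)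
  then show ?thesis using z by (simp add: prod_zero_iff)
qed

definition section_of :: "nat \<Rightarrow> (CxC4 \<Rightarrow> complex) \<Rightarrow> (CxC4, CxC4 set) param \<Rightarrow> CxC4 \<Rightarrow> CxC4 list list \<Rightarrow> complex" where
  "section_of r F c x uss =
     (if c \<in> atlas \<and> x \<in> fst c then F x * tensor (replicate r (\<Omega> x)) uss else 0)"

lemma half_DIM: "DIM(CxC4) div 2 = 5"
  by simp

lemma tensor_Omega_invariant:
  "tensor (replicate r (\<Omega> (act \<gamma> g))) (map (map (dact \<gamma>)) uss) = tensor (replicate r (\<Omega> g)) uss"
  by (auto simp: tensor_replicate Omega_invariant intro!: prod.cong)

lemma tensor_Omega_us0: "tensor (replicate r (\<Omega> g)) (replicate r us0) = \<Omega> g us0 ^ r"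
  by (simp add: tensor_replicate)

text \<open>Turns a section on the quotient into one function on the covering space. Comparing two
  charts at the same point is the case \<gamma> = 0 of comparing them along \<Gamma>, so chart
  independence and invariance come from the same compatibility condition.\<close>

lemma pluricanonical_sectionE:
  assumes "\<sigma> \<in> pluricanonical_sections atlas (J_N5 l1 l2 t) r"
  obtains F where "\<sigma> = section_of r F" "\<forall>\<gamma>\<in>\<Gamma>. \<forall>g. F (act \<gamma> g) = F g"
proof -
  define k where "k c x = \<sigma> c x (replicate r us0) / \<Omega> x us0 ^ r" for c x
  have \<sigma>: "\<sigma> c x = (\<lambda>uss. k c x * tensor (replicate r (\<Omega> x)) uss)" if "c \<in> atlas" "x \<in> fst c" for c x
  proof -
    have "\<sigma> c x \<in> cspan {tensor (replicate r (\<Omega> x))}"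
      using assms that unfolding pluricanonical_sections_def half_DIM J_N5_def
      by (auto simp: Lambda_power_eq[unfolded top_form_eq])
    then obtain a where a: "\<sigma> c x = (\<lambda>uss. a * tensor (replicate r (\<Omega> x)) uss)"
      unfolding cspan_singleton by blast
    then have "k c x = a" by (simp add: k_def tensor_Omega_us0 Omega_us0)
    then show ?thesis using a by simp
  qed
  have inv: "k c x = k c' (act \<gamma> x)"
    if "c \<in> atlas" "x \<in> fst c" "c' \<in> atlas" "\<gamma> \<in> \<Gamma>" "act \<gamma> x \<in> fst c'" for c c' x \<gamma>
  proof -
    note tr = transition_act[OF that(1,3,2,4,5)]
    have "\<sigma> c x uss = \<sigma> c' (act \<gamma> x) (map (map (dact \<gamma>)) uss)" for uss
      using assms that(1-3) tr unfolding pluricanonical_sections_def by force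
    from this[of "replicate r us0"] show ?thesis
      unfolding \<sigma>[OF that(1,2)] \<sigma>[OF that(3,5)] tensor_Omega_invariant
      by (simp add: tensor_Omega_us0 Omega_us0)
  qed
  define F where "F x = k (SOME c. c \<in> atlas \<and> x \<in> fst c) x" for x
  have chart: "(SOME c. c \<in> atlas \<and> x \<in> fst c) \<in> atlas" "x \<in> fst (SOME c. c \<in> atlas \<and> x \<in> fst c)" for x
    using someI_ex[of "\<lambda>c. c \<in> atlas \<and> x \<in> fst c"] atlas_cover[of x] by blast+
  have F: "k c x = F x" if "c \<in> atlas" "x \<in> fst c" for c x
    using inv[OF that chart(1)[of x] Gamma_0] chart(2)[of x] by (simp add: F_def act_0)
  show ?thesis
  proof
    show "\<sigma> = section_of r F"
    proof (intro ext)
      fix c x uss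
      show "\<sigma> c x uss = section_of r F c x uss"
      proof (cases "c \<in> atlas \<and> x \<in> fst c")
        case False
        then have "\<sigma> c x uss = 0" using assms unfolding pluricanonical_sections_def by blast
        then show ?thesis using False by (auto simp: section_of_def)
      qed (use \<sigma>[of c x] F[of c x] in \<open>simp add: section_of_def\<close>)
    qed
    show "\<forall>\<gamma>\<in>\<Gamma>. \<forall>g. F (act \<gamma> g) = F g"
      unfolding F_def by (intro ballI allI) (rule inv[symmetric, OF chart chart(1) _ chart(2)])
  qed
qed

text \<open>F is a sum of products of the coefficients of whatever presentation
  \<open>has_dbar_power\<close> supplies, and these inherit differentiability from the sections. The
  Leibniz rule on tensors then assembles the differential of F, while each of the r factors adds one
  copy of the connection term.\<close>

lemma holomorphic_coefficient:
  assumes "section_of r F \<in> H0 atlas (J_N5 l1 l2 t) r"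
  shows "\<exists>F'. (F has_derivative F') (at g) \<and>
    (\<forall>v. F' v + \<i> * F' (\<J> g v) + of_nat r * (\<i> * of_real (\<alpha> * l2)) * F g * cnj (fst v) = 0)"
proof -
  obtain c where c: "c \<in> atlas" "g \<in> fst c" using atlas_cover by blast
  then have "has_dbar_power 5 \<J> r (section_of r F c) g (\<lambda>_. 0)"
    using assms unfolding H0_def half_DIM J_N5_def by auto
  then obtain V n s where V: "open V" "g \<in> V"
    and s: "\<And>l i. l < n \<Longrightarrow> i < r \<Longrightarrow> s l i \<in> canonical_sections 5 \<J> V"
    and \<sigma>: "\<And>y. y \<in> V \<Longrightarrow> section_of r F c y = (\<lambda>uss. \<Sum>l<(n::nat). tensor (map (\<lambda>i. s l i y) [0..<r]) uss)"
    and zero: "(\<lambda>_. 0) = (\<lambda>(v, uss). if length uss = r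
          then \<Sum>l<n. \<Sum>j<r. dbar 5 \<J> (s l j) g (v, uss ! j) * (\<Prod>i\<in>{..<r} - {j}. s l i g (uss ! i))
          else 0)"
    unfolding has_dbar_power_def by blast
  let ?w = "\<lambda>y. \<Omega> y us0"
  let ?a = "\<i> * of_real (\<alpha> * l2)"
  define G where "G l i y = s l i y us0 / ?w y" for l i y
  have sG: "s l i y = (\<lambda>us. G l i y * \<Omega> y us)" if "l < n" "i < r" "y \<in> V" for l i y
  proof -
    have "s l i y \<in> Lambda (\<J> y) 5 0" using s[OF that(1,2)] that(3) by (auto simp: canonical_sections_def)
    then obtain a where "s l i y = (\<lambda>us. a * \<Omega> y us)" by (metis Lambda_topE top_form_eq)
    then show ?thesis by (simp add: G_def Omega_us0)
  qed
  have "\<exists>G'. (G l i has_derivative G') (at g)" if "l < n" "i < r" for l i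
  proof -
    have "smooth_on V (\<lambda>y. s l i y us0)" using s[OF that] by (auto simp: canonical_sections_def)
    then obtain s' where "((\<lambda>y. s l i y us0) has_derivative s') (at g)"
      using smooth_on_imp_derivative V(2) by blast
    moreover obtain w' where "(?w has_derivative w') (at g)"
      using Omega_has_derivative by blast
    ultimately show ?thesis unfolding G_def[abs_def] using has_derivative_divide' Omega_us0 by blast
  qed
  then obtain G' where G': "\<And>l i. l < n \<Longrightarrow> i < r \<Longrightarrow> (G l i has_derivative G' l i) (at g)" by metis
  define Q where "Q l j = (\<Prod>i\<in>{..<r} - {j}. G l i g)" for l j
  define F' where "F' v = (\<Sum>l<n. \<Sum>j<r. G' l j v * Q l j)" for v
  have F: "F y = (\<Sum>l<n. \<Prod>i<r. G l i y)" if "y \<in> V \<inter> fst c" for y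
  proof -
    have "F y * ?w y ^ r = (\<Sum>l<n. \<Prod>i<r. s l i y us0)"
      using fun_cong[OF \<sigma>[of y], of "replicate r us0"] that c(1)
      by (simp add: section_of_def tensor_Omega_us0 tensor_def)
    also have "\<dots> = (\<Sum>l<n. \<Prod>i<r. G l i y) * ?w y ^ r"
      using that sG by (simp add: prod.distrib sum_distrib_right)
    finally show ?thesis by (simp add: Omega_us0)
  qed
  have deriv: "(F has_derivative F') (at g)"
  proof (rule has_derivative_transform_within_open)
    show "((\<lambda>y. \<Sum>l<n. \<Prod>i<r. G l i y) has_derivative F') (at g)"
      unfolding F'_def[abs_def] Q_def
      by (intro has_derivative_sum has_derivative_prod) (use G' in auto)
    show "open (V \<inter> fst c)" using V(1) c(1) by (auto simp: N5_def)
  qed (use V(2) c(2) F in auto)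
  moreover have "F' v + \<i> * F' (\<J> g v) + of_nat r * ?a * F g * cnj (fst v) = 0" for v
  proof -
    define B where "B l j = (G' l j v + \<i> * G' l j (\<J> g v)) / 2 + G l j g * (?a / 2) * cnj (fst v)" for l j
    have dbar: "dbar 5 \<J> (s l j) g (v, us) = B l j * \<Omega> g us" if "l < n" "j < r" for l j us
      using dbar_scaled[OF V sG[OF that] G'[OF that]] by (simp add: B_def)
    have "0 = (\<Sum>l<n. \<Sum>j<r. dbar 5 \<J> (s l j) g (v, us0) * (\<Prod>i\<in>{..<r} - {j}. s l i g us0))"
      using fun_cong[OF zero, of "(v, replicate r us0)"] by simp
    also have "\<dots> = (\<Sum>l<n. \<Sum>j<r. (B l j * Q l j) * ?w g ^ r)"
    proof (intro sum.cong refl)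
      fix l j assume lj: "l \<in> {..<n}" "j \<in> {..<r}"
      then have "(\<Prod>i\<in>{..<r} - {j}. s l i g us0) = Q l j * ?w g ^ (r - 1)"
        using sG V(2) by (simp add: Q_def prod.distrib)
      moreover have "?w g * ?w g ^ (r - 1) = ?w g ^ r"
        using lj by (cases r) auto
      ultimately show "dbar 5 \<J> (s l j) g (v, us0) * (\<Prod>i\<in>{..<r} - {j}. s l i g us0) = (B l j * Q l j) * ?w g ^ r"
        using lj by (simp add: dbar)
    qed
    also have "\<dots> = (\<Sum>l<n. \<Sum>j<r. B l j * Q l j) * ?w g ^ r"
      by (simp add: sum_distrib_right)
    finally have "(\<Sum>l<n. \<Sum>j<r. B l j * Q l j) = 0" by (simp add: Omega_us0)
    \<comment> \<open>Doubling clears the halves of the (0,1)-part and of the connection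
      term.\<close>
    moreover have "2 * (\<Sum>l<n. \<Sum>j<r. B l j * Q l j)
        = F' v + \<i> * F' (\<J> g v) + (\<Sum>l<n. \<Sum>j<r. G l j g * Q l j) * (?a * cnj (fst v))"
      unfolding F'_def B_def
      by (simp add: sum_distrib_left sum_distrib_right flip: sum.distrib)
        (intro sum.cong refl, simp add: field_simps)
    moreover have "(\<Sum>l<n. \<Sum>j<r. G l j g * Q l j) = of_nat r * F g"
    proof -
      have "G l j g * Q l j = (\<Prod>i<r. G l i g)" if "j < r" for l j
        unfolding Q_def using that by (simp add: prod.remove[of "{..<r}" j])
      then have "(\<Sum>l<n. \<Sum>j<r. G l j g * Q l j) = (\<Sum>l<n. of_nat r * (\<Prod>i<r. G l i g))" by simp
      then show ?thesis using F[of g] V(2) c(2) by (simp add: sum_distrib_left)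
    qed
    ultimately show ?thesis by (simp add: mult_ac)
  qed
  ultimately show ?thesis by blast
qed

end

section \<open>Plurigenera\<close>

context nakamura
begin

text \<open>For a function f of x alone, the equation in \<open>holomorphic_coefficient\<close>
  becomes f' = - \<i> r \<alpha> l2 f, because Re v + \<i> Re (\<i> v) = cnj v. This is the solution
  with value 1 at x = 0.\<close>

definition model :: "nat \<Rightarrow> CxC4 \<Rightarrow> complex" where
  "model r g = exp (- (\<i> * of_real (of_nat r * \<alpha> * l2)) * of_real (Re (fst g)))"

lemma invariant_bounded:
  assumes "continuous_on UNIV F" "\<And>\<gamma> g. \<gamma> \<in> \<Gamma> \<Longrightarrow> F (act \<gamma> g) = (F g :: complex)"
  shows "bounded (range F)"
proof -
  obtain R where R: "\<And>g. \<exists>\<gamma>\<in>\<Gamma>. act \<gamma> g \<in> cball 0 R" using Gamma_cobounded by blast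
  have "compact (F ` cball 0 R)"
    using assms(1) continuous_on_subset by (intro compact_continuous_image) auto
  moreover have "range F \<subseteq> F ` cball 0 R" using R assms(2) by (metis image_eqI image_subsetI)
  ultimately show ?thesis using bounded_subset compact_imp_bounded by blast
qed

text \<open>
  On the fibres \<open>F\<close> is holomorphic along complex lines for the constant structure \<open>\<J> g\<close>; along the
  base, \<open>F\<close> times \<open>exp (\<i> r \<alpha> l2 x)\<close> is holomorphic. Both are bounded, so Liouville applies twice.
\<close>

lemma coefficient_eq:
  assumes inv: "\<And>\<gamma> g. \<gamma> \<in> \<Gamma> \<Longrightarrow> F (act \<gamma> g) = F g"
    and hol: "\<And>g. \<exists>F'. (F has_derivative F') (at g) \<and>
      (\<forall>v. F' v + \<i> * F' (\<J> g v) + of_nat r * (\<i> * of_real (\<alpha> * l2)) * F g * cnj (fst v) = 0)"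
  obtains C where "F = (\<lambda>g. C * model r g)" "C = 0 \<or> (\<exists>m::int. of_nat r * \<alpha> * l2 = 2 * pi * of_int m)"
proof -
  define c where "c = of_nat r * \<alpha> * l2"
  have "of_nat r * (\<i> * of_real (\<alpha> * l2)) = \<i> * of_real c" by (simp add: c_def)
  from hol[unfolded this] obtain D where D: "\<And>g. (F has_derivative D g) (at g)"
    and eq: "\<And>g v. D g v + \<i> * D g (\<J> g v) + \<i> * of_real c * F g * cnj (fst v) = 0"
    by metis
  have lin: "linear (D g)" for g using D has_derivative_linear by blast
  have "continuous_on UNIV F"
    using has_derivative_continuous[OF D] by (simp add: continuous_at_imp_continuous_on)
  then have bdd: "bounded (range F)" using inv by (rule invariant_bounded)
  have fibre: "F (z, v) = F (z, 0)" for z v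
  proof -
    define u where "u = (0::complex, v)"
    \<comment> \<open>The complex line through (z, 0) in direction u, with J in place of
      multiplication by \<i>. It stays in the fibre over z, where J is constant, so
      \<open>F \<circ> p\<close> is holomorphic in the ordinary sense.\<close>
    define p where "p s = (z, 0) + (Re s *\<^sub>R u + Im s *\<^sub>R \<J> (z, 0) u)" for s
    have "((F \<circ> p) has_field_derivative D (p s) u) (at s)" for s
    proof -
      have "(p has_derivative (\<lambda>ds. Re ds *\<^sub>R u + Im ds *\<^sub>R \<J> (z, 0) u)) (at s)"
        unfolding p_def by (auto intro!: derivative_eq_intros)
      then have d: "((F \<circ> p) has_derivative D (p s) \<circ> (\<lambda>ds. Re ds *\<^sub>R u + Im ds *\<^sub>R \<J> (z, 0) u)) (at s)"
        by (rule diff_chain_at) (rule D)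
      have J: "\<J> (p s) = \<J> (z, 0)" by (rule J_Re_cong) (simp add: p_def u_def fst_J)
      have "D (p s) u + \<i> * D (p s) (\<J> (z, 0) u) = 0" using eq[of "p s" u] J by (simp add: u_def)
      then have "\<i> * (D (p s) u + \<i> * D (p s) (\<J> (z, 0) u)) = 0" by simp
      then have "D (p s) (\<J> (z, 0) u) = \<i> * D (p s) u" by (simp add: algebra_simps)
      then have "D (p s) \<circ> (\<lambda>ds. Re ds *\<^sub>R u + Im ds *\<^sub>R \<J> (z, 0) u) = (\<lambda>ds. D (p s) u * ds)"
        by (simp add: fun_eq_iff linear_add[OF lin] linear_complex_scaleR[OF lin] complex_eq_iff algebra_simps)
      then show ?thesis using d by (simp add: has_field_derivative_def)
    qed
    then have "(F \<circ> p) holomorphic_on UNIV"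
      by (auto simp: holomorphic_on_def field_differentiable_def)
    moreover have "bounded (range (F \<circ> p))" using bdd by (rule bounded_subset) auto
    ultimately have "(F \<circ> p) constant_on UNIV" by (rule Liouville_theorem)
    then have "(F \<circ> p) 1 = (F \<circ> p) 0" unfolding constant_on_def by auto
    then show ?thesis by (simp add: p_def u_def)
  qed
  \<comment> \<open>An integrating factor of modulus 1: its derivative cancels the zeroth order
    term, and boundedness is preserved.\<close>
  define k where "k z = F (z, 0) * exp (\<i> * of_real c * of_real (Re z))" for z
  have "(k has_field_derivative - \<i> * D (z, 0) (\<i>, 0) * exp (\<i> * of_real c * of_real (Re z))) (at z)" for z
  proof -
    define E where "E z = exp (\<i> * of_real c * of_real (Re z))" for z
    have "((\<lambda>z. (z, 0::complex^4)) has_derivative (\<lambda>w. (w, 0))) (at z)"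
      by (auto intro!: derivative_eq_intros)
    from diff_chain_at[OF this D] have dF: "((\<lambda>z. F (z, 0)) has_derivative (\<lambda>w. D (z, 0) (w, 0))) (at z)"
      by (simp add: o_def)
    have "((\<lambda>z. \<i> * of_real c * complex_of_real (Re z)) has_derivative (\<lambda>w. \<i> * of_real c * complex_of_real (Re w))) (at z)"
      by (auto intro!: derivative_eq_intros)
    from has_derivative_compose[OF this DERIV_exp[unfolded has_field_derivative_def]]
    have dE: "(E has_derivative (\<lambda>w. E z * (\<i> * of_real c * of_real (Re w)))) (at z)"
      unfolding E_def by simp
    let ?a = "D (z, 0) (1, 0)" and ?b = "D (z, 0) (\<i>, 0)"
    have "?a + \<i> * ?b + \<i> * of_real c * F (z, 0) = 0"
      using eq[of "(z, 0)" "(1, 0)"] by (simp add: J_base)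
    \<comment> \<open>The equation in the direction of x, solved for the x-derivative. The whole
      differential along the base is thus governed by the y-derivative \<open>?b\<close>.\<close>
    then have ab: "?a = - \<i> * ?b - \<i> * of_real c * F (z, 0)" by algebra
    have Dw: "D (z, 0) (w, 0) = of_real (Re w) * ?a + of_real (Im w) * ?b" for w
    proof -
      have "(w, 0) = Re w *\<^sub>R (1, 0::complex^4) + Im w *\<^sub>R (\<i>, 0)" by (simp add: complex_eq_iff)
      then have "D (z, 0) (w, 0) = D (z, 0) (Re w *\<^sub>R (1, 0) + Im w *\<^sub>R (\<i>, 0))" by (rule arg_cong)
      then show ?thesis by (simp only: linear_add[OF lin] linear_complex_scaleR[OF lin])
    qed
    have "F (z, 0) * (E z * (\<i> * of_real c * of_real (Re w))) + D (z, 0) (w, 0) * E z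
        = - \<i> * ?b * E z * (of_real (Re w) + \<i> * of_real (Im w))" for w
      unfolding Dw[of w] ab by (simp add: algebra_simps)
    then have "F (z, 0) * (E z * (\<i> * of_real c * of_real (Re w))) + D (z, 0) (w, 0) * E z
        = - \<i> * ?b * E z * w" for w
      by (simp only: complex_eq[symmetric])
    then have "(\<lambda>w. F (z, 0) * (E z * (\<i> * of_real c * of_real (Re w))) + D (z, 0) (w, 0) * E z)
        = (*) (- \<i> * ?b * E z)" by blast
    moreover have "k = (\<lambda>z. F (z, 0) * E z)" by (simp add: k_def E_def fun_eq_iff)
    ultimately show ?thesis
      using has_derivative_mult[OF dF dE] by (simp add: has_field_derivative_def E_def)
  qed
  then have "k holomorphic_on UNIV"
    by (auto simp: holomorphic_on_def field_differentiable_def)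
  moreover have "bounded (range k)"
  proof -
    obtain b where b: "\<And>g. norm (F g) \<le> b" using bdd unfolding bounded_iff by blast
    have "norm (k z) \<le> b" for z using b[of "(z, 0)"] by (simp add: k_def norm_mult)
    then show ?thesis by (auto simp: bounded_iff)
  qed
  ultimately have "k constant_on UNIV" by (rule Liouville_theorem)
  then obtain C where C: "\<And>z. k z = C" unfolding constant_on_def by blast
  have F: "F g = C * model r g" for g
  proof -
    have "exp (\<i> * of_real c * of_real (Re (fst g))) * model r g = 1"
      unfolding model_def c_def[symmetric] by (subst exp_add[symmetric]) simp
    then have "F (fst g, 0) = k (fst g) * model r g" by (simp only: k_def mult.assoc mult_1_right)
    then show ?thesis using fibre[of "fst g" "snd g"] C by simp
  qed
  \<comment> \<open>This element moves the origin to x = 1, so invariance of F becomes a periodicity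
    condition on the exponential unless C = 0.\<close>
  have "(1, 0) \<in> \<Gamma>"
    using GammaI[OF L_0 L_0, of 1 0] by (simp add: complex_vec_def zero_vec_def Complex_eq)
  then have "C * model r (1, 0) = C * model r 0"
    using inv[of "(1, 0)" 0] by (simp add: F sdprod_def rho_def zero_vec_def[symmetric])
  moreover have "\<exists>m::int. c = 2 * pi * of_int m" if "model r (1, 0) = model r 0"
  proof -
    have "exp (- (\<i> * of_real c)) = 1" using that by (simp add: model_def c_def)
    then obtain n :: int where "- c = of_int (2 * n) * pi" by (auto simp: exp_eq_1)
    then have "c = 2 * pi * of_int (- n)" by (simp add: minus_equation_iff[of c] mult_ac)
    then show ?thesis by blast
  qed
  ultimately have "C = 0 \<or> (\<exists>m::int. c = 2 * pi * of_int m)" by auto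
  then have "C = 0 \<or> (\<exists>m::int. of_nat r * \<alpha> * l2 = 2 * pi * of_int m)" by (simp only: c_def)
  moreover have "F = (\<lambda>g. C * model r g)" using F by blast
  ultimately show ?thesis using that by blast
qed

lemma section_of_scale: "section_of r (\<lambda>g. C * F g) = scale_section C (section_of r F)"
  by (auto simp: section_of_def fun_eq_iff)

lemma H0_subset:
  assumes "\<sigma> \<in> H0 atlas (J_N5 l1 l2 t) r"
  obtains C where "\<sigma> = scale_section C (section_of r (model r))"
    "C = 0 \<or> (\<exists>m::int. of_nat r * \<alpha> * l2 = 2 * pi * of_int m)"
proof -
  have "\<sigma> \<in> pluricanonical_sections atlas (J_N5 l1 l2 t) r" using assms by (simp add: H0_def)
  then obtain F where F: "\<sigma> = section_of r F" "\<forall>\<gamma>\<in>\<Gamma>. \<forall>g. F (act \<gamma> g) = F g"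
    by (rule pluricanonical_sectionE)
  have "section_of r F \<in> H0 atlas (J_N5 l1 l2 t) r" using assms F(1) by simp
  from coefficient_eq[OF F(2)[rule_format] holomorphic_coefficient[OF this]]
  obtain C where C: "F = (\<lambda>g. C * model r g)" "C = 0 \<or> (\<exists>m::int. of_nat r * \<alpha> * l2 = 2 * pi * of_int m)"
    by metis
  show ?thesis by (rule that[OF _ C(2)]) (simp only: F(1) C(1) section_of_scale)
qed

text \<open>Exhibits the candidate section as the r-th tensor power of \<open>model 1\<close> times
  \<Omega>, a presentation with a single summand for \<open>has_dbar_power\<close>.\<close>

lemma model_power: "model r g = model 1 g ^ r"
  by (simp add: model_def exp_of_nat_mult[symmetric] mult_ac)

lemma tensor_model:
  "tensor (replicate r (\<lambda>us. model 1 g * \<Omega> g us)) uss = model r g * tensor (replicate r (\<Omega> g)) uss"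
  by (simp add: tensor_replicate prod.distrib model_power[of r])

lemma model_smooth: "smooth_on U (model r)"
  unfolding model_def[abs_def] by (rule smooth_on_exp)

text \<open>The resonance condition makes \<open>model r\<close> invariant under \<Gamma>, which
  shifts x by integers. The Dolbeault equation is checked on one tensor factor, where the derivative
  of \<open>model 1\<close> cancels the connection term.\<close>

lemma model_in_H0:
  fixes m :: int
  assumes "of_nat r * \<alpha> * l2 = 2 * pi * of_int m"
  shows "section_of r (model r) \<in> H0 atlas (J_N5 l1 l2 t) r"
proof -
  define c where "c = of_nat r * \<alpha> * l2"
  have model_inv: "model r (act \<gamma> g) = model r g" if \<gamma>: "\<gamma> \<in> \<Gamma>" for \<gamma> g
  proof -
    obtain n :: int where "Re (fst \<gamma>) = of_int n" using \<gamma> by (auto simp: Gamma_iff)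
    then have "model r (act \<gamma> g)
        = exp (- (\<i> * of_real c) * of_real (Re (fst g)) + - (\<i> * of_real c) * of_int n)"
      by (simp add: model_def sdprod_def c_def distrib_left add.commute)
    also have "\<dots> = model r g * exp (- (\<i> * of_real c) * of_int n)"
      by (simp only: exp_add model_def c_def)
    finally have "model r (act \<gamma> g) = model r g * exp (- (\<i> * of_real c) * of_int n)" .
    moreover have "exp (- (\<i> * of_real c) * of_int n) = 1"
      unfolding exp_eq_1 using assms by (auto simp: c_def intro!: exI[of _ "- m * n"])
    ultimately show ?thesis by simp
  qed
  have smooth: "smooth_on U (\<lambda>x. section_of r (model r) c x uss)" if "c \<in> atlas" "U = fst c" for c uss U
  proof (rule smooth_on_cong)
    show "open U" using that by (auto simp: N5_def)
    show "smooth_on U (\<lambda>x. model r x * tensor (replicate r (\<Omega> x)) uss)"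
      unfolding tensor_replicate
      by (cases "length uss = r")
        (simp_all add: smooth_on_const smooth_on_mult model_smooth smooth_on_prod Omega_smooth)
  qed (use that in \<open>simp add: section_of_def\<close>)
  have "section_of r (model r) \<in> pluricanonical_sections atlas (J_N5 l1 l2 t) r"
    unfolding pluricanonical_sections_def half_DIM J_N5_def mem_Collect_eq
  proof (intro conjI allI ballI impI)
    fix c x assume "c \<in> atlas" "x \<in> fst c"
    then have "section_of r (model r) c x = (\<lambda>uss. model r x * tensor (replicate r (\<Omega> x)) uss)"
      by (simp add: section_of_def fun_eq_iff)
    then show "section_of r (model r) c x \<in> Lambda_power (\<J> x) 5 r"
      by (auto simp: Lambda_power_eq[unfolded top_form_eq] cspan_singleton)
  next
    fix c c' x uss
    assume c: "c \<in> atlas" "c' \<in> atlas" and x: "x \<in> fst c" and "snd c x \<in> snd c' ` fst c'"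
    then obtain \<gamma> where \<gamma>: "\<gamma> \<in> \<Gamma>" "act \<gamma> x \<in> fst c'" using atlas_overlapD[OF c] by blast
    show "section_of r (model r) c x uss = section_of r (model r) c' (transition c c' x)
        (map (map (frechet_derivative (transition c c') (at x))) uss)"
      unfolding transition_act(2,3)[OF c x \<gamma>]
      using c x \<gamma> by (simp add: section_of_def model_inv tensor_Omega_invariant)
  qed (use smooth in \<open>auto simp: section_of_def\<close>)
  moreover have "has_dbar_power 5 \<J> r (section_of r (model r) c) g (\<lambda>_. 0)"
    if c: "c \<in> atlas" "g \<in> fst c" for c g
  proof -
    define s where "s y us = model 1 y * \<Omega> y us" for y us
    have op: "open (fst c)" using c by (auto simp: N5_def)
    have "s \<in> canonical_sections 5 \<J> (fst c)"
      unfolding canonical_sections_def s_def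
      by (auto simp: Lambda_top top_form_eq cspan_singleton intro!: smooth_on_mult model_smooth Omega_smooth)
    moreover have "section_of r (model r) c y = tensor (map (\<lambda>i. s y) [0..<r])" if "y \<in> fst c" for y
      using that c tensor_model[of r y] unfolding s_def
      by (simp add: section_of_def fun_eq_iff map_replicate_trivial map_replicate_const)
    moreover have "dbar 5 \<J> s g = (\<lambda>_. 0)"
    proof -
      let ?G' = "\<lambda>v. - (\<i> * of_real (\<alpha> * l2)) * of_real (Re (fst v)) * model 1 g"
      have "(model 1 has_derivative ?G') (at g)"
        unfolding model_def[abs_def] using exp_Re_has_derivative[of "- (\<i> * of_real (\<alpha> * l2))" g] by simp
      then have "dbar 5 \<J> s g = (\<lambda>(v, us). ((?G' v + \<i> * ?G' (\<J> g v)) / 2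
          + model 1 g * (\<i> * of_real (\<alpha> * l2) / 2) * cnj (fst v)) * \<Omega> g us)"
        by (intro dbar_scaled[OF op c(2)]) (auto simp: s_def)
      moreover have "(?G' v + \<i> * ?G' (\<J> g v)) / 2 + model 1 g * (\<i> * of_real (\<alpha> * l2) / 2) * cnj (fst v) = 0" for v
      proof -
        have "cnj (fst v) = of_real (Re (fst v)) + \<i> * of_real (Re (\<i> * fst v))"
          by (simp add: complex_eq_iff)
        then show ?thesis by (simp only: fst_J) (simp add: field_simps)
      qed
      ultimately show ?thesis by auto
    qed
    ultimately show ?thesis
      unfolding has_dbar_power_def using op c(2)
      by (intro exI[of _ "fst c"] exI[of _ 1] exI[of _ "\<lambda>_ _. s"]) auto
  qed
  ultimately show ?thesis by (simp add: H0_def half_DIM J_N5_def)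
qed

lemma section_of_nonzero: "section_of r (model r) \<noteq> 0"
proof
  assume zero: "section_of r (model r) = 0"
  obtain c where "c \<in> atlas" "(0::CxC4) \<in> fst c" using atlas_cover by blast
  then have "section_of r (model r) c 0 (replicate r us0) \<noteq> 0"
    by (simp add: section_of_def tensor_Omega_us0 Omega_us0 model_def)
  then show False by (simp add: zero)
qed

lemma plurigenus_eq:
  "plurigenus atlas (J_N5 l1 l2 t) r
     = (if \<exists>m::int. of_nat r * \<alpha> * l2 = 2 * pi * of_int m then 1 else 0)"
proof -
  let ?H = "H0 atlas (J_N5 l1 l2 t) r"
  let ?\<sigma> = "section_of r (model r)"
  show ?thesis
  proof (cases "\<exists>m::int. of_nat r * \<alpha> * l2 = 2 * pi * of_int m")
    case True
    have "?H \<subseteq> csec.span {?\<sigma>}"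
    proof
      fix \<sigma> assume "\<sigma> \<in> ?H"
      then obtain C where "\<sigma> = scale_section C ?\<sigma>" by (rule H0_subset)
      then show "\<sigma> \<in> csec.span {?\<sigma>}" using csec.span_scale[OF csec.span_base] by blast
    qed
    moreover have "{?\<sigma>} \<subseteq> ?H" using True model_in_H0 by blast
    moreover have "csec.independent {?\<sigma>}" using section_of_nonzero by (simp add: csec.dependent_single)
    ultimately have "csec.dim ?H = card {?\<sigma>}" by (intro csec.basis_card_eq_dim[symmetric])
    then show ?thesis
      using True \<open>?H \<subseteq> csec.span {?\<sigma>}\<close> unfolding plurigenus_def
      by (auto simp: one_enat_def intro!: exI[of _ "{?\<sigma>}"])
  next
    case False
    have "?H \<subseteq> csec.span {}"
    proof
      fix \<sigma> assume "\<sigma> \<in> ?H"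
      then obtain C where "\<sigma> = scale_section C ?\<sigma>" "C = 0" using False by (metis H0_subset)
      then show "\<sigma> \<in> csec.span {}" by (simp add: zero_fun_def)
    qed
    moreover have "csec.independent {}" by (rule csec.independent_empty)
    ultimately have "csec.dim ?H = card ({} :: ((CxC4, CxC4 set) param \<Rightarrow> CxC4 \<Rightarrow> CxC4 list list \<Rightarrow> complex) set)"
      by (intro csec.basis_card_eq_dim[symmetric]) auto
    then show ?thesis
      using False \<open>?H \<subseteq> csec.span {}\<close> unfolding plurigenus_def
      by (auto simp: zero_enat_def intro!: exI[of _ "{}"])
  qed
qed

lemma resonance_iff:
  assumes "k \<ge> 1"
  shows "(\<exists>m::int. of_nat k * \<alpha> * l2 = 2 * pi * of_int m)
     \<longleftrightarrow> \<alpha> \<in> {2 * pi / (real_of_int (int k) * l2) * real_of_int m | m :: int. True}"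
  using assms l2_nonzero by (auto simp: field_simps)

end

text \<open>The numerators are -\<infinity> or 0. From r = 2 on ln r is positive, so no term is
  positive there. Along the multiples of k the numerator is 0, which makes the quotient 0 for every
  denominator, including the values 0 of ln at 0 and 1.\<close>

lemma limsup_log_plurigenus:
  fixes p :: "nat \<Rightarrow> enat"
  assumes p: "\<And>r. p r = 0 \<or> p r = 1" and one: "k \<ge> 1" "\<And>n. p (n * k) = 1"
  shows "limsup (\<lambda>r. log_enat (p r) / ereal (ln (real r))) = 0"
proof (rule antisym)
  let ?X = "\<lambda>r. log_enat (p r) / ereal (ln (real r))"
  have log: "log_enat 0 = - \<infinity>" "log_enat 1 = 0"
    by (simp_all add: log_enat_def zero_enat_def one_enat_def)
  have "?X r \<le> 0" if "r \<ge> 2" for r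
    using p[of r] that by (auto simp: log)
  then show "limsup ?X \<le> 0"
    by (intro Limsup_bounded) (auto simp: eventually_sequentially)
  have "strict_mono (\<lambda>n. n * k)" using one(1) by (auto simp: strict_mono_def)
  then have "limsup (?X \<circ> (\<lambda>n. n * k)) \<le> limsup ?X" by (rule limsup_subseq_mono)
  moreover have "?X \<circ> (\<lambda>n. n * k) = (\<lambda>_. 0)" by (simp add: fun_eq_iff one(2) log)
  ultimately show "0 \<le> limsup ?X" by (simp add: Limsup_const)
qed

theorem proposition4p1:
  fixes M :: "int^4^4" and P :: "real^4^4" and l1 l2 \<tau> :: real
  assumes "det M = 1"
    and "invertible P"
    and "P ** map_matrix real_of_int M ** matrix_inv P = exp_diag l1 l2"
    and "l2 \<noteq> 0"
    and "\<tau> \<noteq> 0"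
  shows "\<exists>\<epsilon>>0. \<forall>t :: real^2. norm t < \<epsilon> \<longrightarrow>
    kodaira_dim (N5 P \<tau> l1 l2) (J_N5 l1 l2 t) =
      (if \<forall>k::int. k \<ge> 1 \<longrightarrow>
            alpha t \<notin> {2 * pi / (real_of_int k * l2) * real_of_int m | m :: int. True}
       then - \<infinity> else 0)"
proof (intro exI[of _ "1::real"] conjI allI impI)
  \<comment> \<open>With radius 1, smallness of t is the assumption of
    \<open>nakamura_forms\<close>.\<close>
  fix t :: "real^2" assume "norm t < 1"
  then interpret nakamura l1 l2 t M P \<tau> by unfold_locales (use assms in auto)
  let ?p = "plurigenus atlas (J_N5 l1 l2 t)"
  let ?R = "\<lambda>r. \<exists>m::int. of_nat r * \<alpha> * l2 = 2 * pi * of_int m"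
  have p: "?p r = (if ?R r then 1 else 0)" for r by (rule plurigenus_eq)
  let ?Q = "\<forall>k::int. k \<ge> 1 \<longrightarrow>
      \<alpha> \<notin> {2 * pi / (real_of_int k * l2) * real_of_int m | m :: int. True}"
  have Q: "?Q \<longleftrightarrow> (\<forall>r\<ge>1. \<not> ?R r)"
  proof
    assume Q: ?Q
    show "\<forall>r\<ge>1. \<not> ?R r"
    proof (intro allI impI)
      fix r :: nat assume "r \<ge> 1"
      then show "\<not> ?R r" unfolding resonance_iff[OF \<open>r \<ge> 1\<close>] using Q[rule_format, of "int r"] by simp
    qed
  next
    assume R: "\<forall>r\<ge>1. \<not> ?R r"
    show ?Q
    proof (intro allI impI)
      fix k :: int assume "k \<ge> 1"
      then obtain r where r: "k = int r" "r \<ge> 1" by (metis nat_0_le nat_mono nat_one_as_int order.trans zero_le_one One_nat_def nat_1)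
      show "\<alpha> \<notin> {2 * pi / (real_of_int k * l2) * real_of_int m | m :: int. True}"
        using R r(2) unfolding r(1) resonance_iff[OF r(2), symmetric] by blast
    qed
  qed
  show "kodaira_dim atlas (J_N5 l1 l2 t) = (if ?Q then - \<infinity> else 0)"
  proof (cases "\<forall>r\<ge>1. \<not> ?R r")
    case True
    then have "\<forall>r\<ge>1. ?p r = 0" by (simp add: p)
    then show ?thesis unfolding Q kodaira_dim_def using True by simp
  next
    case False
    then obtain k and m :: int where k: "k \<ge> 1" "of_nat k * \<alpha> * l2 = 2 * pi * of_int m" by blast
    \<comment> \<open>Multiples of a resonant index are resonant; they supply the subsequence for
      the limes superior.\<close>
    have R: "?R (n * k)" for n
      using k(2) by (intro exI[of _ "of_nat n * m"]) (simp add: mult_ac)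
    have "limsup (\<lambda>r. log_enat (?p r) / ereal (ln (real r))) = 0"
      by (rule limsup_log_plurigenus[of _ k]) (use p k(1) R in auto)
    moreover have "?p k \<noteq> 0" using p[of k] k by auto
    then have "\<not> (\<forall>r\<ge>1. ?p r = 0)" using k(1) by blast
    ultimately show ?thesis unfolding Q kodaira_dim_def using False by simp
  qed
qed simp

end
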